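(* Let $\alpha>-1$ be a real number, let $L u=-\Delta u-\alpha\,\mathrm{grad}\,\mathrm{div}\,u$ be the 3D Lamé system acting on vector functions $u=(u_1,u_2,u_3)^T$ on $\mathbb{R}^3$, and let $\Phi$ be its fundamental matrix. Then $L$ is positive definite with weight $\Phi$ when $\alpha_-<\alpha<\alpha_+$, where $\alpha_-\approx-0.194$ and $\alpha_+\approx1.524$. Moreover, $L$ is not positive definite with weight $\Phi$ when $\alpha<\alpha_-^{(c)}\approx-0.902$ or $\alpha>\alpha_+^{(c)}\approx39.450$. The constants $\alpha_\pm$, $\alpha_\pm^{(c)}$ are the specific real numbers defined in the context.
   Context: Repeated indices are summed from $1$ to $3$; $D_k=\partial/\partial x_k$, $D_{ki}=D_kD_i$. In components $(Lu)_i=-D_{kk}u_i-\alpha D_{ki}u_k$, $i=1,2,3$. The standing assumption $\alpha>-1$ is equivalent to strong ellipticity of $L$. Fundamental matrix: $\Phi=(\Phi_{ij})_{i,j=1}^3$ with $\Phi_{ij}(x)=c_\alpha r^{-1}\bigl(\delta_{ij}+\frac{\alpha}{\alpha+2}\omega_i\omega_j\bigr)$, where $c_\alpha=\frac{\alpha+2}{8\pi(\alpha+1)}$, $r=|x|$, $\omega_i=x_i/|x|$, and $\delta_{ij}$ is the Kronecker delta. Positive definiteness: $L$ is positive definite with weight $\Psi(x)=(\Psi_{ij}(x))_{i,j=1}^3$ if $$\int_{\mathbb{R}^3}(Lu)^T\Psi u\,dx=-\int_{\mathbb{R}^3}\bigl[D_{kk}u_i(x)+\alpha D_{ki}u_k(x)\bigr]u_j(x)\Psi_{ij}(x)\,dx\ge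 0$$ for all real-valued smooth vector functions $u=(u_i)_{i=1}^3$ with $u_i\in C_0^\infty(\mathbb{R}^3\setminus\{0\})$. Constants: $\alpha_+$ is the largest real root of $6t^5+(23+3\sqrt2)t^4+(13+19\sqrt2)t^3-(77-38\sqrt2)t^2-(157-24\sqrt2)t-96$. $\alpha_-$ is the smallest real root of $-(2+7\sqrt3)t^4+2(15+\sqrt2-11\sqrt3+\sqrt6)t^3+2(57+3\sqrt2-10\sqrt3+3\sqrt6)t^2+6(20+\sqrt2+\sqrt6)t+24$. $\alpha_-^{(c)}$ and $\alpha_+^{(c)}$ are the smallest and the largest real roots, respectively, of $q(t)=(t+1)(3t+4)^2-\frac{t^4}{4}$. *)

theory Defs
  imports "HOL-Analysis.Analysis"
begin

definition pd :: "3 \<Rightarrow> (real^3 \<Rightarrow> real) \<Rightarrow> real^3 \<Rightarrow> real" where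
  "pd k f x = deriv (\<lambda>h. f (x + h *\<^sub>R axis k 1)) 0"

definition scalar_laplacian :: "(real^3 \<Rightarrow> real) \<Rightarrow> real^3 \<Rightarrow> real" where
  "scalar_laplacian f x = (\<Sum>k\<in>UNIV. pd k (pd k f) x)"

definition vec_laplacian :: "(real^3 \<Rightarrow> real^3) \<Rightarrow> real^3 \<Rightarrow> real^3" where
  "vec_laplacian u x = (\<chi> i. scalar_laplacian (\<lambda>y. u y $ i) x)"

definition gradient :: "(real^3 \<Rightarrow> real) \<Rightarrow> real^3 \<Rightarrow> real^3" where
  "gradient f x = (\<chi> i. pd i f x)"

definition divergence :: "(real^3 \<Rightarrow> real^3) \<Rightarrow> real^3 \<Rightarrow> real" where
  "divergence u x = (\<Sum>k\<in>UNIV. pd k (\<lambda>y. u y $ k) x)"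

definition lame :: "real \<Rightarrow> (real^3 \<Rightarrow> real^3) \<Rightarrow> real^3 \<Rightarrow> real^3" where
  "lame \<alpha> u x = - vec_laplacian u x - \<alpha> *\<^sub>R gradient (divergence u) x"

text \<open>Frechet differentiability of every iterated partial derivative makes all of them
  continuous, so this is membership in $C^\infty(\mathbb{R}^3)$.\<close>

definition smooth :: "(real^3 \<Rightarrow> real) \<Rightarrow> bool" where
  "smooth f \<longleftrightarrow> (\<forall>ks :: 3 list. foldr pd ks f differentiable_on UNIV)"

definition supp :: "(real^3 \<Rightarrow> real) \<Rightarrow> (real^3) set" where
  "supp f = closure {x. f x \<noteq> 0}"

text \<open>Elements of $C_0^\infty(\mathbb{R}^3 \setminus \{0\})$ are identified with their
  extensions by zero to the whole space.\<close>

definition test_fun :: "(real^3 \<Rightarrow> real) \<Rightarrow> bool" where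
  "test_fun f \<longleftrightarrow> smooth f \<and> compact (supp f) \<and> 0 \<notin> supp f"

text \<open>The integrand is $(Lu)^T \Psi u = \sum_{i,j} (Lu)_i \Psi_{ij} u_j$. For a Lame operator and a weight
  that is continuous off the origin, the integrand is continuous with compact support when $u$ is a
  test function, so the Bochner integral exists.\<close>

definition pos_def_with_weight ::
  "((real^3 \<Rightarrow> real^3) \<Rightarrow> real^3 \<Rightarrow> real^3) \<Rightarrow> (real^3 \<Rightarrow> real^3^3) \<Rightarrow> bool" where
  "pos_def_with_weight L \<Psi> \<longleftrightarrow>
     (\<forall>u :: real^3 \<Rightarrow> real^3. (\<forall>i. test_fun (\<lambda>x. u x $ i)) \<longrightarrow>
        (LINT x|lborel. L u x \<bullet> (\<Psi> x *v u x)) \<ge> 0)"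

definition c_lame :: "real \<Rightarrow> real" where
  "c_lame \<alpha> = (\<alpha> + 2) / (8 * pi * (\<alpha> + 1))"

text \<open>Division by zero gives a default value at the origin, which test functions never see.\<close>

definition fundamental_matrix :: "real \<Rightarrow> real^3 \<Rightarrow> real^3^3" where
  "fundamental_matrix \<alpha> x = (\<chi> i j. c_lame \<alpha> / norm x *
     ((if i = j then 1 else 0) + \<alpha> / (\<alpha> + 2) * (x $ i / norm x) * (x $ j / norm x)))"

definition alpha_plus :: real where
  "alpha_plus = Max {t. 6 * t^5 + (23 + 3 * sqrt 2) * t^4 + (13 + 19 * sqrt 2) * t^3
     - (77 - 38 * sqrt 2) * t^2 - (157 - 24 * sqrt 2) * t - 96 = 0}"

definition alpha_minus :: real where
  "alpha_minus = Min {t. - (2 + 7 * sqrt 3) * t^4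
     + 2 * (15 + sqrt 2 - 11 * sqrt 3 + sqrt 6) * t^3
     + 2 * (57 + 3 * sqrt 2 - 10 * sqrt 3 + 3 * sqrt 6) * t^2
     + 6 * (20 + sqrt 2 + sqrt 6) * t + 24 = 0}"

definition q_crit :: "real \<Rightarrow> real" where
  "q_crit t = (t + 1) * (3 * t + 4)^2 - t^4 / 4"

definition alpha_c_minus :: real where
  "alpha_c_minus = Min {t. q_crit t = 0}"

definition alpha_c_plus :: real where
  "alpha_c_plus = Max {t. q_crit t = 0}"

end

theory Submission
  imports Defs
begin

text \<open>Write \<open>\<rho> = 1 / r\<close>, \<open>\<kappa> = \<alpha> / (\<alpha> + 2)\<close>, \<open>G = Du\<close>. Integrating by parts and using that \<open>L\<close> annihilates the
  columns of \<open>\<Phi>\<close>, the form becomes \<open>c\<^sub>\<alpha> \<integral> \<rho> (|G|\<^sup>2 + \<kappa> |G\<omega>|\<^sup>2 + \<alpha> tr G (tr G + \<kappa> \<omega>\<cdot>G\<omega>))\<close> plus a term bilinear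
  in \<open>u\<close> and \<open>G\<close>. This cross term is itself the integral of a null Lagrangian with weight: it equals \<open>-2 \<kappa> \<rho>\<close> times
  the minor of \<open>G\<close> on the plane orthogonal to \<open>\<omega>\<close>, up to a divergence. Hence the form is the integral of a
  quadratic form in \<open>G\<close> alone, which is pointwise nonnegative for \<open>-0.3 \<le> \<alpha> \<le> 2\<close>, a range that contains
  \<open>[\<alpha>\<^sub>-, \<alpha>\<^sub>+]\<close>. In the other direction, for \<open>u\<close> oscillating with frequency \<open>N\<close> the form grows like \<open>N\<^sup>2\<close> times the symmetrised
  symbol \<open>(|\<xi>|\<^sup>2 + \<alpha> \<xi>\<xi>\<^sup>T) \<Phi>\<close>, which is indefinite for a suitable angle between \<open>\<xi>\<close> and \<open>x\<close> as soon as
  \<open>4 (\<alpha> + 1) (3 \<alpha> + 4)\<^sup>2 < \<alpha>\<^sup>2 (\<alpha> + 2)\<^sup>2\<close>; this is implied by \<open>q(\<alpha>) < 0\<close>.\<close>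

subsection \<open>Partial derivatives and integration by parts\<close>

lemma has_derivative_line:
  assumes f: "(f has_derivative f') (at (x + t *\<^sub>R axis k 1))"
  shows "((\<lambda>h. f (x + h *\<^sub>R axis k 1)) has_real_derivative f' (axis k 1)) (at t)"
proof -
  have "((\<lambda>h. f (x + h *\<^sub>R axis k 1)) has_derivative (\<lambda>h. f' (h *\<^sub>R axis k 1))) (at t)"
    by (rule has_derivative_compose[where g = f and f = "\<lambda>h. x + h *\<^sub>R axis k 1"])
      (use f in \<open>auto intro!: derivative_eq_intros\<close>)
  moreover have "f' (h *\<^sub>R axis k 1) = f' (axis k 1) * h" for h
    using linear_cmul[OF has_derivative_linear[OF f]] by (simp add: mult.commute)
  ultimately show ?thesis
    by (simp add: has_field_derivative_def)
qed

lemma pd_eqI: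
  assumes "(f has_derivative f') (at x)"
  shows "pd k f x = f' (axis k 1)"
  unfolding pd_def
  by (rule DERIV_imp_deriv, rule has_derivative_line) (use assms in simp)

lemma pd_line:
  assumes "f differentiable (at (x + t *\<^sub>R axis k 1))"
  shows "((\<lambda>h. f (x + h *\<^sub>R axis k 1)) has_real_derivative pd k f (x + t *\<^sub>R axis k 1)) (at t)"
  using assms has_derivative_line pd_eqI unfolding differentiable_def by metis

lemma pd_const: "pd k (\<lambda>x. c) x = 0"
  by (subst pd_eqI[of _ "\<lambda>_. 0"]) auto

lemma pd_add:
  assumes "f differentiable (at x)" "g differentiable (at x)"
  shows "pd k (\<lambda>x. f x + g x) x = pd k f x + pd k g x"
proof -
  obtain f' g' where d: "(f has_derivative f') (at x)" "(g has_derivative g') (at x)"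
    using assms by (auto simp: differentiable_def)
  show ?thesis
    by (subst pd_eqI[OF has_derivative_add[OF d]]) (simp add: pd_eqI[OF d(1)] pd_eqI[OF d(2)])
qed

lemma pd_mult:
  assumes "f differentiable (at x)" "g differentiable (at x)"
  shows "pd k (\<lambda>x. f x * g x) x = pd k f x * g x + f x * pd k g x"
proof -
  obtain f' g' where d: "(f has_derivative f') (at x)" "(g has_derivative g') (at x)"
    using assms by (auto simp: differentiable_def)
  show ?thesis
    by (subst pd_eqI[OF has_derivative_mult[OF d]]) (simp add: pd_eqI[OF d(1)] pd_eqI[OF d(2)])
qed

lemma pd_uminus:
  assumes "f differentiable (at x)"
  shows "pd k (\<lambda>x. - f x) x = - pd k f x"
  using pd_mult[OF differentiable_const[of "-1"] assms] by (simp add: pd_const)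

lemma pd_diff:
  assumes "f differentiable (at x)" "g differentiable (at x)"
  shows "pd k (\<lambda>x. f x - g x) x = pd k f x - pd k g x"
  using pd_add[OF assms(1) differentiable_minus[OF assms(2)]] by (simp add: pd_uminus assms)

lemma pd_divide_const:
  assumes "f differentiable (at x)"
  shows "pd k (\<lambda>x. f x / c) x = pd k f x / c"
  using pd_mult[OF assms differentiable_const[of "1 / c"]] by (simp add: pd_const)

lemma pd_sum:
  assumes "finite I" "\<And>i. i \<in> I \<Longrightarrow> f i differentiable (at x)"
  shows "pd k (\<lambda>x. \<Sum>i\<in>I. f i x) x = (\<Sum>i\<in>I. pd k (f i) x)"
  using assms
proof (induction I rule: finite_induct)
  case (insert i I)
  then have "(\<lambda>x. \<Sum>i\<in>I. f i x) differentiable (at x)"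
    by (intro differentiable_sum) auto
  with insert show ?case by (simp add: pd_add)
qed (simp add: pd_const)

lemma pd_coord: "pd k (\<lambda>x. x $ i) x = (if i = k then 1 else 0)"
proof -
  have "((\<lambda>x::real^3. x $ i) has_derivative (\<lambda>x. x $ i)) (at x)"
    by (simp add: bounded_linear_imp_has_derivative bounded_linear_vec_nth)
  from pd_eqI[OF this] show ?thesis by (simp add: axis_def)
qed

text \<open>The derivative is kept as a polynomial in the coordinates and \<open>1 / norm x\<close>,
  so that further differentiation needs only the sum and product rules.\<close>

lemma pd_norm_inverse:
  assumes "x \<noteq> 0"
  shows "pd k (\<lambda>x. 1 / norm x) x = - (x $ k * (1 / norm x)^3)"
proof -
  have "((\<lambda>x. 1 / norm x) has_derivative (\<lambda>h. - (1 / (norm x * norm x) * (h \<bullet> sgn x)))) (at x)"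
    using assms by (auto intro!: derivative_eq_intros has_derivative_norm simp: field_simps)
  from pd_eqI[OF this] show ?thesis
    by (simp add: sgn_vec_def inner_axis' power3_eq_cube field_simps)
qed

lemma pd_cong_open:
  assumes "open S" "x \<in> S" "\<And>y. y \<in> S \<Longrightarrow> f y = g y"
  shows "pd k f x = pd k g x"
proof -
  have "((\<lambda>h. x + h *\<^sub>R axis k 1) \<longlongrightarrow> x + 0 *\<^sub>R axis k (1::real)) (at 0)"
    by (intro tendsto_intros)
  then have "\<forall>\<^sub>F h in at 0. x + h *\<^sub>R axis k 1 \<in> S"
    using assms(1,2) by (auto elim!: topological_tendstoD)
  then have "\<forall>\<^sub>F h in nhds 0. f (x + h *\<^sub>R axis k 1) = g (x + h *\<^sub>R axis k 1)"
    unfolding eventually_nhds_conv_at using assms by (auto elim!: eventually_mono)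
  then show ?thesis
    unfolding pd_def by (intro deriv_cong_ev) auto
qed

text \<open>Schwarz's theorem. The second difference \<open>D h i j\<close> is symmetric in
  \<open>i\<close> and \<open>j\<close>. The mean value theorem, applied first in direction
  \<open>i\<close> and then in direction \<open>j\<close>, makes it \<open>h * h\<close> times a
  mixed derivative at a point near \<open>x\<close>; continuity and \<open>h = 1 / Suc n\<close>
  then identify both limits.\<close>

lemma pd_commute:
  assumes f: "\<And>x. f differentiable (at x)"
    and f1: "\<And>k x. pd k f differentiable (at x)"
    and f2: "\<And>k l. continuous_on UNIV (pd k (pd l f))"
  shows "pd i (pd j f) x = pd j (pd i f) x"
proof -
  let ?e = "\<lambda>k. axis k (1::real) :: real^3"
  define D where "D h i j = f (x + h *\<^sub>R ?e i + h *\<^sub>R ?e j) - f (x + h *\<^sub>R ?e i) - f (x + h *\<^sub>R ?e j) + f x"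
    for h i j
  have key: "\<exists>s t. 0 < s \<and> s < h \<and> 0 < t \<and> t < h \<and>
      D h i j = h * h * pd j (pd i f) (x + s *\<^sub>R ?e i + t *\<^sub>R ?e j)"
    if h: "h > 0" for h i j
  proof -
    have d: "((\<lambda>s. f ((x + h *\<^sub>R ?e j) + s *\<^sub>R ?e i) - f (x + s *\<^sub>R ?e i)) has_real_derivative
        pd i f ((x + h *\<^sub>R ?e j) + s *\<^sub>R ?e i) - pd i f (x + s *\<^sub>R ?e i)) (at s)" for s
      by (intro DERIV_diff pd_line f)
    obtain s where s: "0 < s" "s < h"
      "f ((x + h *\<^sub>R ?e j) + h *\<^sub>R ?e i) - f (x + h *\<^sub>R ?e i) - (f (x + h *\<^sub>R ?e j) - f x)
        = h * (pd i f ((x + h *\<^sub>R ?e j) + s *\<^sub>R ?e i) - pd i f (x + s *\<^sub>R ?e i))"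
      using MVT2[OF h, of "\<lambda>s. f ((x + h *\<^sub>R ?e j) + s *\<^sub>R ?e i) - f (x + s *\<^sub>R ?e i)", OF d]
      by auto
    obtain t where t: "0 < t" "t < h"
      "pd i f ((x + s *\<^sub>R ?e i) + h *\<^sub>R ?e j) - pd i f (x + s *\<^sub>R ?e i)
        = h * pd j (pd i f) ((x + s *\<^sub>R ?e i) + t *\<^sub>R ?e j)"
      using MVT2[OF h, of "\<lambda>t. pd i f ((x + s *\<^sub>R ?e i) + t *\<^sub>R ?e j)", OF pd_line[OF f1]]
      by auto
    show ?thesis
      by (rule exI[of _ s], rule exI[of _ t]) (use s t in \<open>simp add: D_def algebra_simps\<close>)
  qed
  have lim: "(\<lambda>n. D (1 / Suc n) i j / (1 / Suc n * (1 / Suc n))) \<longlonglongrightarrow> pd j (pd i f) x" for i j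
  proof -
    have "\<forall>n. \<exists>st. 0 < fst st \<and> fst st < 1 / Suc n \<and> 0 < snd st \<and> snd st < 1 / Suc n \<and>
      D (1 / Suc n) i j = 1 / Suc n * (1 / Suc n) * pd j (pd i f) (x + fst st *\<^sub>R ?e i + snd st *\<^sub>R ?e j)"
      using key[of "1 / Suc n" i j for n] by simp
    then obtain st where st: "\<And>n. 0 < fst (st n)" "\<And>n. fst (st n) < 1 / Suc n"
      "\<And>n. 0 < snd (st n)" "\<And>n. snd (st n) < 1 / Suc n"
      "\<And>n. D (1 / Suc n) i j
          = 1 / Suc n * (1 / Suc n) * pd j (pd i f) (x + fst (st n) *\<^sub>R ?e i + snd (st n) *\<^sub>R ?e j)"
      by metis
    have n0: "(\<lambda>n. 1 / real (Suc n)) \<longlonglongrightarrow> 0"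
      using LIMSEQ_inverse_real_of_nat by (simp add: inverse_eq_divide)
    have "(\<lambda>n. fst (st n)) \<longlonglongrightarrow> 0" "(\<lambda>n. snd (st n)) \<longlonglongrightarrow> 0"
      by (rule tendsto_sandwich[OF _ _ tendsto_const n0]; use st in \<open>simp add: less_imp_le\<close>)+
    then have "(\<lambda>n. x + fst (st n) *\<^sub>R ?e i + snd (st n) *\<^sub>R ?e j) \<longlonglongrightarrow> x + 0 *\<^sub>R ?e i + 0 *\<^sub>R ?e j"
      by (intro tendsto_intros)
    then have "(\<lambda>n. pd j (pd i f) (x + fst (st n) *\<^sub>R ?e i + snd (st n) *\<^sub>R ?e j)) \<longlonglongrightarrow> pd j (pd i f) x"
      using f2[of j i] by (intro isCont_tendsto_compose[of x "pd j (pd i f)"])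
        (auto simp: continuous_on_eq_continuous_at)
    moreover have "D (1 / Suc n) i j / (1 / Suc n * (1 / Suc n))
        = pd j (pd i f) (x + fst (st n) *\<^sub>R ?e i + snd (st n) *\<^sub>R ?e j)" for n
      unfolding st(5)[of n] by simp
    ultimately show ?thesis
      by simp
  qed
  have "D h i j = D h j i" for h
    by (simp add: D_def algebra_simps)
  then show ?thesis
    using LIMSEQ_unique lim[of j i] lim[of i j] by simp
qed

text \<open>Integration over \<open>\<real>\<^sup>3\<close> is translation invariant, so every difference quotient integrates to zero.\<close>

lemma integral_pd_compact_support:
  fixes F :: "real^3 \<Rightarrow> real"
  assumes F: "\<And>x. F differentiable (at x)" and cont: "continuous_on UNIV (pd k F)"
    and K: "compact K" and zero: "\<And>x. x \<notin> K \<Longrightarrow> F x = 0"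
  shows "integrable lborel (pd k F)" "(LINT x|lborel. pd k F x) = 0"
proof -
  let ?e = "axis k (1::real) :: real^3"
  let ?g = "\<lambda>n x. real (Suc n) * (F (x + (1 / real (Suc n)) *\<^sub>R ?e) - F x)"
  \<comment> \<open>The union of all translates of \<open>K\<close> by at most one unit against the
    direction \<open>?e\<close>. It is compact and carries every difference quotient
    \<open>?g n\<close>, since \<open>1 / Suc n \<le> 1\<close>.\<close>
  let ?K = "(\<lambda>z. fst z - snd z *\<^sub>R ?e) ` (K \<times> {0..1})"
  have contF: "continuous_on UNIV F"
    using F by (simp add: continuous_at_imp_continuous_on differentiable_imp_continuous_within)
  have pd0: "pd k F x = 0" if "x \<notin> K" for x
    using pd_cong_open[of "-K" x F "\<lambda>_. 0"] K that zero
    by (auto simp: compact_imp_closed pd_const open_Compl)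
  have K': "compact ?K"
    by (intro compact_continuous_image compact_Times K) (auto intro!: continuous_intros)
  have KK': "x \<in> K \<Longrightarrow> x \<in> ?K" for x
    by (rule image_eqI[of _ _ "(x, 0)"]) auto
  obtain M where M: "\<And>x. x \<in> K \<Longrightarrow> \<bar>pd k F x\<bar> \<le> M"
    using compact_imp_bounded[OF compact_continuous_image[OF continuous_on_subset[OF cont] K]]
    by (auto simp: bounded_iff)
  have M': "\<bar>pd k F x\<bar> \<le> max M 0" for x
    using M[of x] pd0[of x] by (cases "x \<in> K") auto
  \<comment> \<open>The dominating function: by the mean value theorem each quotient is a value of
    \<open>pd k F\<close>, which is bounded, and off \<open>?K\<close> both values of
    \<open>F\<close> vanish.\<close>
  have g: "\<bar>?g n x\<bar> \<le> max M 0 * indicator ?K x" for n x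
  proof (cases "x \<in> ?K")
    case True
    have "0 < 1 / real (Suc n)" by simp
    from MVT2[OF this, of "\<lambda>h. F (x + h *\<^sub>R ?e)", OF pd_line[OF F]] obtain z where
      "F (x + (1 / real (Suc n)) *\<^sub>R ?e) - F x = 1 / real (Suc n) * pd k F (x + z *\<^sub>R ?e)"
      by auto
    then have "?g n x = pd k F (x + z *\<^sub>R ?e)" by simp
    then show ?thesis using M' True by simp
  next
    case False
    have "x \<notin> K" using KK' False by blast
    moreover have "x + (1 / real (Suc n)) *\<^sub>R ?e \<notin> K"
    proof
      assume "x + (1 / real (Suc n)) *\<^sub>R ?e \<in> K"
      then have "x \<in> ?K"
        by (intro image_eqI[of _ _ "(x + (1 / real (Suc n)) *\<^sub>R ?e, 1 / real (Suc n))"]) auto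
      with False show False by simp
    qed
    ultimately show ?thesis using zero False by simp
  qed
  have intF: "integrable lborel F"
  proof -
    have "integrable lborel (\<lambda>x. indicator K x *\<^sub>R F x)"
      by (intro borel_integrable_compact K continuous_on_subset[OF contF]) auto
    moreover have "(\<lambda>x. indicator K x *\<^sub>R F x) = F"
      using zero by (force simp: indicator_def)
    ultimately show ?thesis by simp
  qed
  have intK: "integrable lborel (\<lambda>x. max M 0 * indicator ?K x)"
    using borel_integrable_compact[OF K', of "\<lambda>_. max M 0"] by (simp add: mult.commute)
  have shift: "integrable lborel (\<lambda>x. F (x + a))" "(LINT x|lborel. F (x + a)) = (LINT x|lborel. F x)" for a
  proof -
    have [measurable]: "F \<in> borel_measurable borel"
      using contF by (rule borel_measurable_continuous_onI)
    have eq: "distr lborel borel ((+) a) = (lborel :: (real^3) measure)"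
      by (rule lborel_distr_plus)
    show "integrable lborel (\<lambda>x. F (x + a))"
      using integrable_distr[of "(+) a" lborel borel F] intF eq by (simp add: add.commute)
    show "(LINT x|lborel. F (x + a)) = (LINT x|lborel. F x)"
      using integral_distr[of "(+) a" lborel borel F] eq by (simp add: add.commute)
  qed
  have g0: "(LINT x|lborel. ?g n x) = 0" for n
    using shift intF by simp
  have lim: "(\<lambda>n. ?g n x) \<longlonglongrightarrow> pd k F x" for x
  proof -
    have "((\<lambda>h. (F (x + (0 + h) *\<^sub>R ?e) - F (x + 0 *\<^sub>R ?e)) / h) \<longlongrightarrow> pd k F (x + 0 *\<^sub>R ?e)) (at 0)"
      using pd_line[OF F, of x k 0] unfolding DERIV_def .
    moreover have "filterlim (\<lambda>n. 1 / real (Suc n)) (at 0) sequentially"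
      using LIMSEQ_inverse_real_of_nat by (auto simp: filterlim_at inverse_eq_divide)
    ultimately have "(\<lambda>n. (F (x + (0 + 1 / real (Suc n)) *\<^sub>R ?e) - F (x + 0 *\<^sub>R ?e)) / (1 / real (Suc n)))
        \<longlonglongrightarrow> pd k F (x + 0 *\<^sub>R ?e)"
      by (rule filterlim_compose)
    then show ?thesis by (simp add: mult.commute)
  qed
  have meas: "pd k F \<in> borel_measurable lborel" "\<And>n. ?g n \<in> borel_measurable lborel"
    using borel_measurable_continuous_onI[OF cont] shift(1) intF by auto
  show "integrable lborel (pd k F)"
    by (rule integrable_dominated_convergence[where s = ?g, OF _ _ intK]) (use lim g meas in auto)
  have "(\<lambda>n. LINT x|lborel. ?g n x) \<longlonglongrightarrow> (LINT x|lborel. pd k F x)"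
    by (rule integral_dominated_convergence[where s = ?g, OF _ _ intK]) (use lim g meas in auto)
  then show "(LINT x|lborel. pd k F x) = 0"
    unfolding g0 using LIMSEQ_unique tendsto_const by blast
qed

subsection \<open>The quadratic form in the gradient\<close>

lemma quadratic_form_nonneg:
  fixes A B C x y :: real
  assumes "0 < A" "B\<^sup>2 \<le> 4 * A * C"
  shows "0 \<le> A * x\<^sup>2 + B * (x * y) + C * y\<^sup>2"
proof -
  have "4 * A * (A * x\<^sup>2 + B * (x * y) + C * y\<^sup>2) = (2 * A * x + B * y)\<^sup>2 + (4 * A * C - B\<^sup>2) * y\<^sup>2"
    by (simp add: power2_eq_square algebra_simps)
  also have "\<dots> \<ge> 0" using assms by simp
  finally show ?thesis using assms by (simp add: zero_le_mult_iff)
qed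

text \<open>The last bracket is twice the minor of \<open>G\<close> on the plane orthogonal to the unit vector \<open>\<omega>\<close>. It occurs
  because, up to a divergence, it represents the terms bilinear in \<open>u\<close> and \<open>Du\<close>.\<close>

definition gradient_form :: "real \<Rightarrow> (3 \<Rightarrow> real) \<Rightarrow> (3 \<Rightarrow> 3 \<Rightarrow> real) \<Rightarrow> real" where
  "gradient_form \<alpha> \<omega> G =
    (let \<kappa> = \<alpha> / (\<alpha> + 2); t = \<Sum>k\<in>UNIV. G k k; a = \<Sum>i\<in>UNIV. \<Sum>j\<in>UNIV. \<omega> i * G i j * \<omega> j in
     (\<Sum>k\<in>UNIV. \<Sum>i\<in>UNIV. (G k i)\<^sup>2) + \<kappa> * (\<Sum>k\<in>UNIV. (\<Sum>i\<in>UNIV. G k i * \<omega> i)\<^sup>2)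
     + \<alpha> * t * (t + \<kappa> * a)
     - \<kappa> * (t\<^sup>2 - (\<Sum>i\<in>UNIV. \<Sum>j\<in>UNIV. G i j * G j i) - 2 * a * t
        + 2 * (\<Sum>j\<in>UNIV. (\<Sum>i\<in>UNIV. \<omega> i * G i j) * (\<Sum>k\<in>UNIV. G j k * \<omega> k))))"

text \<open>\<open>G\<close> is split along \<omega> and its orthogonal plane: \<open>T\<close> is
  the block acting on that plane, with trace \<open>s\<close>; \<open>p\<close> is G applied to
  \<omega>, \<open>l\<close> its transpose applied to \<omega>, and \<open>a\<close> their common
  component along \<omega>. With \<open>X\<close> the squared norm of \<open>T\<close> and
  \<open>Y\<close> the trace of its square, all variables except \<open>a\<close> and
  \<open>s\<close> are eliminated by lower bounds. What remains is a binary form in \<open>a\<close>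
  and \<open>s\<close>, whose discriminant decides.\<close>

lemma gradient_form_nonneg:
  fixes G :: "3 \<Rightarrow> 3 \<Rightarrow> real"
  assumes \<alpha>: "-0.3 \<le> \<alpha>" "\<alpha> \<le> 2" and \<omega>: "(\<Sum>i\<in>UNIV. (\<omega> i)\<^sup>2) = 1"
  shows "0 \<le> gradient_form \<alpha> \<omega> G"
proof -
  define \<kappa> where "\<kappa> = \<alpha> / (\<alpha> + 2)"
  define t where "t = (\<Sum>k\<in>UNIV. G k k)"
  define p where "p = (\<lambda>k. \<Sum>i\<in>UNIV. G k i * \<omega> i)"
  define l where "l = (\<lambda>j. \<Sum>i\<in>UNIV. \<omega> i * G i j)"
  define a where "a = (\<Sum>i\<in>UNIV. \<Sum>j\<in>UNIV. \<omega> i * G i j * \<omega> j)"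
  define s where "s = t - a"
  define T where "T = (\<lambda>i j. G i j - \<omega> i * l j - p i * \<omega> j + a * \<omega> i * \<omega> j)"
  define X where "X = (\<Sum>i\<in>UNIV. \<Sum>j\<in>UNIV. (T i j)\<^sup>2)"
  define Y where "Y = (\<Sum>i\<in>UNIV. \<Sum>j\<in>UNIV. T i j * T j i)"
  have w: "\<omega> 1 * \<omega> 1 + \<omega> 2 * \<omega> 2 + \<omega> 3 * \<omega> 3 = 1"
    using \<omega> by (simp add: sum_3 power2_eq_square)
  have wl: "\<omega> 1 * l 1 + \<omega> 2 * l 2 + \<omega> 3 * l 3 = a" "\<omega> 1 * p 1 + \<omega> 2 * p 2 + \<omega> 3 * p 3 = a"
    by (simp_all add: l_def p_def a_def sum_3 algebra_simps)
  have ld: "\<omega> 1 * G 1 j + \<omega> 2 * G 2 j + \<omega> 3 * G 3 j = l j" for j by (simp add: l_def sum_3)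
  have pd: "G j 1 * \<omega> 1 + G j 2 * \<omega> 2 + G j 3 * \<omega> 3 = p j" for j by (simp add: p_def sum_3)
  have Tw: "\<omega> 1 * T 1 j + \<omega> 2 * T 2 j + \<omega> 3 * T 3 j = 0"
     "T j 1 * \<omega> 1 + T j 2 * \<omega> 2 + T j 3 * \<omega> 3 = 0" for j
    unfolding T_def using w wl ld[of j] pd[of j] by algebra+
  have trT: "T 1 1 + T 2 2 + T 3 3 = s"
    unfolding T_def s_def t_def sum_3 using w wl by algebra
  have G: "G = (\<lambda>i j. T i j + \<omega> i * l j + p i * \<omega> j - a * \<omega> i * \<omega> j)"
    by (simp add: T_def fun_eq_iff)
  have X: "(\<Sum>k\<in>UNIV. \<Sum>i\<in>UNIV. (G k i)\<^sup>2) = X + (\<Sum>k\<in>UNIV. (p k)\<^sup>2) + (\<Sum>k\<in>UNIV. (l k)\<^sup>2) - a\<^sup>2"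
    unfolding X_def sum_3 using w wl Tw[of 1] Tw[of 2] Tw[of 3] unfolding G by algebra
  have Y: "(\<Sum>i\<in>UNIV. \<Sum>j\<in>UNIV. G i j * G j i) = Y + 2 * (\<Sum>j\<in>UNIV. l j * p j) - a\<^sup>2"
    unfolding Y_def sum_3 using w wl Tw[of 1] Tw[of 2] Tw[of 3] unfolding G by algebra
  have "0 \<le> (\<Sum>i\<in>UNIV. \<Sum>j\<in>UNIV. (T i j - T j i)\<^sup>2)"
    by (simp add: sum_nonneg)
  then have XY: "Y \<le> X"
    by (simp add: X_def Y_def sum_3 power2_eq_square algebra_simps)
  \<comment> \<open>The symmetric part of \<open>T\<close> minus its multiple of the projector onto
    the plane. The plane has dimension 2, which fixes the coefficient of \<open>s\<close> and yields
    the sharp trace inequality.\<close>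
  have "0 \<le> (\<Sum>i\<in>UNIV. \<Sum>j\<in>UNIV. (T i j + T j i - s * ((if i = j then 1 else 0) - \<omega> i * \<omega> j))\<^sup>2)"
    by (simp add: sum_nonneg)
  also have "\<dots> = 2 * X + 2 * Y - 2 * s\<^sup>2"
    unfolding X_def Y_def sum_3 using w Tw[of 1] Tw[of 2] Tw[of 3] trT by (simp, algebra)
  finally have XYs: "s\<^sup>2 \<le> X + Y" by simp
  have "0 \<le> (\<Sum>i\<in>UNIV. (p i - a * \<omega> i)\<^sup>2)" "0 \<le> (\<Sum>i\<in>UNIV. (l i - a * \<omega> i)\<^sup>2)"
    by (simp_all add: sum_nonneg)
  moreover have "(\<Sum>i\<in>UNIV. (p i - a * \<omega> i)\<^sup>2) = (\<Sum>i\<in>UNIV. (p i)\<^sup>2) - a\<^sup>2"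
    "(\<Sum>i\<in>UNIV. (l i - a * \<omega> i)\<^sup>2) = (\<Sum>i\<in>UNIV. (l i)\<^sup>2) - a\<^sup>2"
    unfolding sum_3 using w wl by algebra+
  ultimately have pl: "a\<^sup>2 \<le> (\<Sum>i\<in>UNIV. (p i)\<^sup>2)" "a\<^sup>2 \<le> (\<Sum>i\<in>UNIV. (l i)\<^sup>2)" by simp_all
  have \<kappa>: "1 + \<kappa> > 0" "1 - \<kappa> > 0" using \<alpha> by (simp_all add: \<kappa>_def field_simps)
  have "gradient_form \<alpha> \<omega> G = X + ((1 + \<kappa>) * (\<Sum>k\<in>UNIV. (p k)\<^sup>2) + (\<Sum>k\<in>UNIV. (l k)\<^sup>2) - a\<^sup>2)
      + \<alpha> * t * (t + \<kappa> * a) - \<kappa> * (s\<^sup>2 - Y)"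
    unfolding gradient_form_def Let_def \<kappa>_def[symmetric] p_def[symmetric] l_def[symmetric]
      t_def[symmetric] a_def[symmetric] X Y s_def
    by (simp add: p_def l_def power2_eq_square algebra_simps)
  \<comment> \<open>\<open>X + \<kappa> * Y\<close> is distributed over the two nonnegative
    quantities \<open>X - Y\<close> and \<open>X + Y - s^2\<close>. Both coefficients are positive
    because \<kappa> lies strictly between -1 and 1.\<close>
  also have "\<dots> = (1 - \<kappa>) / 2 * (X - Y) + (1 + \<kappa>) / 2 * (X + Y - s\<^sup>2) + (1 - \<kappa>) / 2 * s\<^sup>2
      + (1 + \<kappa>) * ((\<Sum>k\<in>UNIV. (p k)\<^sup>2) - a\<^sup>2) + ((\<Sum>k\<in>UNIV. (l k)\<^sup>2) - a\<^sup>2) + (1 + \<kappa>) * a\<^sup>2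
      + \<alpha> * (a + s) * (a + s + \<kappa> * a)"
    by (simp add: s_def field_simps)
  also have "\<dots> \<ge> (1 - \<kappa>) / 2 * s\<^sup>2 + (1 + \<kappa>) * a\<^sup>2 + \<alpha> * (a + s) * (a + s + \<kappa> * a)"
    using \<kappa> XY XYs pl by simp
  finally have "gradient_form \<alpha> \<omega> G
      \<ge> (1 + \<alpha>) * (1 + \<kappa>) * a\<^sup>2 + \<alpha> * (2 + \<kappa>) * (a * s) + ((1 - \<kappa>) / 2 + \<alpha>) * s\<^sup>2"
    by (simp add: power2_eq_square algebra_simps)
  moreover have "0 \<le> (1 + \<alpha>) * (1 + \<kappa>) * a\<^sup>2 + \<alpha> * (2 + \<kappa>) * (a * s) + ((1 - \<kappa>) / 2 + \<alpha>) * s\<^sup>2"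
  proof (rule quadratic_form_nonneg)
    show "0 < (1 + \<alpha>) * (1 + \<kappa>)" using \<kappa> \<alpha> by simp
    have e: "1 + \<kappa> = 2 * (\<alpha> + 1) / (\<alpha> + 2)" "(1 - \<kappa>) / 2 + \<alpha> = (\<alpha> + 1)\<^sup>2 / (\<alpha> + 2)"
      "\<alpha> * (2 + \<kappa>) = \<alpha> * (3 * \<alpha> + 4) / (\<alpha> + 2)"
      using \<alpha> by (simp_all add: \<kappa>_def field_simps power2_eq_square)
    \<comment> \<open>This quartic is the discriminant condition after multiplication by the square
      of \<open>\<alpha> + 2\<close>.\<close>
    have "0 \<le> - (\<alpha>^4) + 8 * \<alpha>^3 + 32 * \<alpha>\<^sup>2 + 32 * \<alpha> + 8"
    proof -
      \<comment> \<open>Expansion at the left endpoint -0.3 leaves only nonnegative terms; the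
        factor \<open>9.2 - y\<close> absorbs the negative leading coefficient.\<close>
      define y where "y = \<alpha> + 0.3"
      have y: "0 \<le> y" "y \<le> 2.3" using \<alpha> by (auto simp: y_def)
      have "- (\<alpha>^4) + 8 * \<alpha>^3 + 32 * \<alpha>\<^sup>2 + 32 * \<alpha> + 8
        = 1.0559 + 15.068 * y + 24.26 * y\<^sup>2 + y^3 * (9.2 - y)"
        by (simp add: y_def power2_eq_square power3_eq_cube power4_eq_xxxx field_simps)
      also have "\<dots> \<ge> 0" using y by (intro add_nonneg_nonneg mult_nonneg_nonneg) auto
      finally show ?thesis .
    qed
    also have "\<dots> = 8 * (\<alpha> + 1)^4 - (\<alpha> * (3 * \<alpha> + 4))\<^sup>2"
      by (simp add: power2_eq_square power3_eq_cube power4_eq_xxxx algebra_simps)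
    finally have "(\<alpha> * (3 * \<alpha> + 4))\<^sup>2 \<le> 8 * (\<alpha> + 1)^4" by simp
    then have "(\<alpha> * (3 * \<alpha> + 4))\<^sup>2 / (\<alpha> + 2)\<^sup>2 \<le> 8 * (\<alpha> + 1)^4 / (\<alpha> + 2)\<^sup>2"
      by (rule divide_right_mono) simp
    also have "8 * (\<alpha> + 1)^4 / (\<alpha> + 2)\<^sup>2
        = 4 * ((\<alpha> + 1) * (2 * (\<alpha> + 1) / (\<alpha> + 2))) * ((\<alpha> + 1)\<^sup>2 / (\<alpha> + 2))"
      by (simp only: power2_eq_square power4_eq_xxxx times_divide_eq_left times_divide_eq_right
          divide_divide_eq_left mult.assoc mult.left_commute[of _ 2])
    finally show "(\<alpha> * (2 + \<kappa>))\<^sup>2 \<le> 4 * ((1 + \<alpha>) * (1 + \<kappa>)) * ((1 - \<kappa>) / 2 + \<alpha>)"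
      unfolding e power_divide by (simp only: add.commute[of 1 \<alpha>])
  qed
  ultimately show ?thesis by linarith
qed

subsection \<open>Functions that are continuously differentiable off the origin\<close>

text \<open>The weights and fluxes are singular only at the origin, near which test functions
  vanish. This class is closed under sums and products, so regularity of long expressions follows by
  introduction rules.\<close>

definition c1_off :: "(real^3 \<Rightarrow> real) \<Rightarrow> bool" where
  "c1_off f \<longleftrightarrow> (\<forall>x. x \<noteq> 0 \<longrightarrow> f differentiable (at x)) \<and> (\<forall>k. continuous_on (-{0}) (pd k f))"

lemma c1_off_differentiable: "c1_off f \<Longrightarrow> x \<noteq> 0 \<Longrightarrow> f differentiable (at x)"
  by (simp add: c1_off_def)

lemma c1_off_continuous: "c1_off f \<Longrightarrow> continuous_on (-{0}) f"
  by (auto simp: c1_off_def intro!: continuous_at_imp_continuous_on differentiable_imp_continuous_within)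

lemma c1_off_continuous_pd: "c1_off f \<Longrightarrow> continuous_on (-{0}) (pd k f)"
  by (simp add: c1_off_def)

lemma c1_offI:
  assumes "\<And>x. x \<noteq> 0 \<Longrightarrow> f differentiable (at x)"
    and "\<And>k x. x \<noteq> 0 \<Longrightarrow> pd k f x = f' k x" "\<And>k. continuous_on (-{0}) (f' k)"
  shows "c1_off f"
proof -
  have "continuous_on (-{0}) (pd k f) \<longleftrightarrow> continuous_on (-{0}) (f' k)" for k
    by (intro continuous_on_cong) (auto simp: assms(2))
  then show ?thesis using assms by (simp add: c1_off_def)
qed

lemma c1_off_const: "c1_off (\<lambda>x. c)"
  by (rule c1_offI[of _ "\<lambda>_ _. 0"]) (auto simp: pd_const)

lemma c1_off_coord: "c1_off (\<lambda>x. x $ i)"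
proof (rule c1_offI[of _ "\<lambda>k _. if i = k then 1 else 0"])
  show "(\<lambda>x. x $ i) differentiable (at x)" for x :: "real^3"
    by (rule bounded_linear_imp_differentiable) (rule bounded_linear_vec_nth)
qed (auto simp: pd_coord)

lemma c1_off_norm_inverse: "c1_off (\<lambda>x. 1 / norm x)"
proof (rule c1_offI[OF _ pd_norm_inverse])
  show "(\<lambda>x. 1 / norm x) differentiable (at x)" if "x \<noteq> 0" for x :: "real^3"
    using that by (auto intro!: derivative_intros differentiable_divide)
qed (auto intro!: continuous_intros)

lemma c1_off_add: "c1_off f \<Longrightarrow> c1_off g \<Longrightarrow> c1_off (\<lambda>x. f x + g x)"
  by (rule c1_offI[OF _ pd_add])
    (auto intro!: continuous_intros simp: c1_off_differentiable c1_off_continuous_pd)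

lemma c1_off_diff: "c1_off f \<Longrightarrow> c1_off g \<Longrightarrow> c1_off (\<lambda>x. f x - g x)"
  by (rule c1_offI[OF _ pd_diff])
    (auto intro!: continuous_intros simp: c1_off_differentiable c1_off_continuous_pd)

lemma c1_off_mult: "c1_off f \<Longrightarrow> c1_off g \<Longrightarrow> c1_off (\<lambda>x. f x * g x)"
  by (rule c1_offI[OF _ pd_mult])
    (auto intro!: continuous_intros simp: c1_off_differentiable c1_off_continuous_pd c1_off_continuous)

lemma c1_off_uminus: "c1_off f \<Longrightarrow> c1_off (\<lambda>x. - f x)"
  using c1_off_diff[OF c1_off_const[of 0]] by simp

lemma c1_off_divide_const: "c1_off f \<Longrightarrow> c1_off (\<lambda>x. f x / c)"
  using c1_off_mult[OF _ c1_off_const[of "1 / c"]] by simp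

lemma c1_off_power: "c1_off f \<Longrightarrow> c1_off (\<lambda>x. f x ^ n)"
  by (induction n) (auto intro: c1_off_mult c1_off_const)

lemma c1_off_sum: "(\<And>i. i \<in> I \<Longrightarrow> c1_off (f i)) \<Longrightarrow> c1_off (\<lambda>x. \<Sum>i\<in>I. f i x)"
  by (induction I rule: infinite_finite_induct) (auto intro: c1_off_add c1_off_const)

lemmas c1_off_intros = c1_off_const c1_off_coord c1_off_norm_inverse c1_off_add c1_off_diff
  c1_off_mult c1_off_divide_const c1_off_uminus c1_off_power c1_off_sum

lemma pd_power3:
  assumes "f differentiable (at x)"
  shows "pd k (\<lambda>x. f x ^ 3) x = 3 * f x ^ 2 * pd k f x"
  using assms by (simp add: power3_eq_cube power2_eq_square pd_mult differentiable_mult)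

lemma pd_power5:
  assumes "f differentiable (at x)"
  shows "pd k (\<lambda>x. f x ^ 5) x = 5 * f x ^ 4 * pd k f x"
proof -
  have "(\<lambda>x. f x ^ 5) = (\<lambda>x. f x ^ 3 * (f x * f x))" by (simp add: fun_eq_iff power_numeral_reduce)
  then show ?thesis
    using assms by (simp add: pd_mult pd_power3 differentiable_mult differentiable_power power_numeral_reduce)
qed

section \<open>Smooth functions, and integration by parts away from the origin\<close>

lemma smooth_pd: "smooth f \<Longrightarrow> smooth (pd k f)"
  unfolding smooth_def
proof
  fix ks assume "\<forall>ks. foldr pd ks f differentiable_on UNIV"
  then have "foldr pd (ks @ [k]) f differentiable_on UNIV" by blast
  then show "foldr pd ks (pd k f) differentiable_on UNIV" by simp
qed

lemma smooth_differentiable: "smooth f \<Longrightarrow> f differentiable (at x)"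
  unfolding smooth_def differentiable_on_def by (metis UNIV_I foldr.simps(1) id_apply)

lemma smooth_continuous: "smooth f \<Longrightarrow> continuous_on UNIV f"
  by (intro continuous_at_imp_continuous_on ballI differentiable_imp_continuous_within
    smooth_differentiable)

lemma smooth_c1_off: "smooth f \<Longrightarrow> c1_off f"
  by (meson c1_off_def continuous_on_subset smooth_continuous smooth_differentiable smooth_pd subset_UNIV)

lemma smooth_pd_commute: "smooth f \<Longrightarrow> pd i (pd j f) x = pd j (pd i f) x"
  by (intro pd_commute smooth_differentiable smooth_continuous smooth_pd)

lemma pd_eq_0_off_closed:
  assumes "closed K" "\<And>x. x \<notin> K \<Longrightarrow> f x = 0" "x \<notin> K"
  shows "pd k f x = 0"
  using pd_cong_open[of "-K" x f "\<lambda>_. 0" k] assms by (auto simp: pd_const)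

text \<open>The open sets \<open>-K\<close> and \<open>-{0}\<close> cover the space because
  \<open>K\<close> avoids the origin; on the first the function is zero.\<close>

lemma continuous_on_UNIV_if_0_off:
  assumes "continuous_on (-{0}) f" "compact K" "0 \<notin> K" "\<And>x. x \<notin> K \<Longrightarrow> f x = 0"
  shows "continuous_on UNIV (f :: real^3 \<Rightarrow> real)"
proof -
  have op: "open (-K)" using assms by (simp add: compact_imp_closed open_Compl)
  have "continuous_on (-K) f" using assms(4)
    by (subst continuous_on_cong[of _ "-K" _ "\<lambda>_. 0"]) auto
  then have "continuous_on (-K \<union> -{0}) f"
    using assms(1) op by (intro continuous_on_open_Un) auto
  moreover have "-K \<union> -{0} = UNIV" using assms by auto
  ultimately show ?thesis by simp
qed

lemma integrable_if_0_off:
  assumes "continuous_on (-{0}) f" "compact K" "0 \<notin> K" "\<And>x. x \<notin> K \<Longrightarrow> f x = 0"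
  shows "integrable lborel (f :: real^3 \<Rightarrow> real)"
proof -
  have "integrable lborel (\<lambda>x. indicator K x *\<^sub>R f x)"
    by (intro borel_integrable_compact assms continuous_on_subset[OF continuous_on_UNIV_if_0_off[OF assms]]) auto
  moreover have "(\<lambda>x. indicator K x *\<^sub>R f x) = f"
    using assms(4) by (force simp: indicator_def)
  ultimately show ?thesis by simp
qed

text \<open>\<open>F\<close> vanishes on the open neighbourhood \<open>-K\<close> of the origin, so
  the singularity is invisible and the result for compact support on the whole space
  applies.\<close>

lemma integral_pd_c1_off:
  assumes F: "c1_off F" and K: "compact K" "0 \<notin> K" and zero: "\<And>x. x \<notin> K \<Longrightarrow> F x = 0"
  shows "integrable lborel (pd k F)" "(LINT x|lborel. pd k F x) = 0"
proof -
  have cl: "closed K" using K by (simp add: compact_imp_closed)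
  have "F differentiable (at x)" for x
  proof (cases "x = 0")
    case True
    have "(F has_derivative (\<lambda>_. 0)) (at x)"
      by (rule has_derivative_transform_within_open[of "\<lambda>_. 0" _ _ _ "-K"])
        (use K cl zero True in auto)
    then show ?thesis by (auto simp: differentiable_def)
  qed (simp add: F c1_off_differentiable)
  moreover have "continuous_on UNIV (pd k F)"
    using K c1_off_continuous_pd[OF F] pd_eq_0_off_closed[OF cl zero]
    by (intro continuous_on_UNIV_if_0_off[of _ K]) auto
  ultimately show "integrable lborel (pd k F)" "(LINT x|lborel. pd k F x) = 0"
    using integral_pd_compact_support[of F k K] K zero by blast+
qed

subsection \<open>The weighted form as a quadratic form in the gradient\<close>

lemma sum_rotate:
  "(\<Sum>i\<in>A. \<Sum>j\<in>B. \<Sum>k\<in>C. f i j k) = (\<Sum>k\<in>C. \<Sum>i\<in>A. \<Sum>j\<in>B. f i j k)"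
proof -
  have "(\<Sum>i\<in>A. \<Sum>j\<in>B. \<Sum>k\<in>C. f i j k) = (\<Sum>i\<in>A. \<Sum>k\<in>C. \<Sum>j\<in>B. f i j k)"
    by (intro sum.cong refl sum.swap)
  then show ?thesis by (subst (asm) sum.swap)
qed

lemma lame_component:
  assumes "\<And>i. smooth (U i)"
  shows "lame \<alpha> (\<lambda>y. \<chi> i. U i y) x $ i
    = - (\<Sum>k\<in>UNIV. pd k (pd k (U i)) x) - \<alpha> * (\<Sum>k\<in>UNIV. pd i (pd k (U k)) x)"
proof -
  have "divergence (\<lambda>y. \<chi> i. U i y) = (\<lambda>y. \<Sum>k\<in>UNIV. pd k (U k) y)"
    by (simp add: fun_eq_iff divergence_def)
  then show ?thesis
    by (simp add: lame_def vec_laplacian_def scalar_laplacian_def gradient_def pd_sum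
        smooth_differentiable smooth_pd assms)
qed

text \<open>The total flux produced when one derivative of the Lame operator is moved off
  \<open>U\<close>. The derivatives of the weight are a separate parameter \<open>dw\<close>, so
  that an explicit formula can take the place of \<open>pd k (w i j)\<close>, with which it need
  agree only off the origin.\<close>

definition weight_flux ::
  "real \<Rightarrow> (3 \<Rightarrow> 3 \<Rightarrow> real^3 \<Rightarrow> real) \<Rightarrow> (3 \<Rightarrow> 3 \<Rightarrow> 3 \<Rightarrow> real^3 \<Rightarrow> real) \<Rightarrow> (3 \<Rightarrow> real^3 \<Rightarrow> real)
    \<Rightarrow> 3 \<Rightarrow> real^3 \<Rightarrow> real" where
  "weight_flux \<alpha> w dw U k y =
    (\<Sum>i\<in>UNIV. \<Sum>j\<in>UNIV. U i y * U j y * dw k i j y / 2 - pd k (U i) y * U j y * w i j y)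
      - \<alpha> * ((\<Sum>l\<in>UNIV. pd l (U l) y) * (\<Sum>j\<in>UNIV. U j y * w k j y))"

text \<open>Moving one derivative in the Laplacian part leaves a term with one derivative on
  \<open>U\<close> and one on \<open>w\<close>. By symmetry of \<open>w\<close> it is half the
  derivative of \<open>U i * U j\<close> against that of \<open>w\<close>, so a second integration
  by parts produces the factor -1/2 and the Laplacian of the weight. The grad-div part is integrated
  by parts once.\<close>

lemma divergence_form:
  assumes u: "\<And>i. smooth (U i)" and sym: "\<And>i j. w i j = w j i" "\<And>k i j. dw k i j = dw k j i"
    and w: "\<And>i j. c1_off (w i j)" "\<And>i j k. c1_off (dw k i j)"
    and dw: "\<And>x k i j. x \<noteq> 0 \<Longrightarrow> pd k (w i j) x = dw k i j x"
    and x: "x \<noteq> 0"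
  shows "(\<Sum>i\<in>UNIV. \<Sum>j\<in>UNIV. lame \<alpha> (\<lambda>y. \<chi> i. U i y) x $ i * w i j x * U j x)
    = (\<Sum>k\<in>UNIV. \<Sum>i\<in>UNIV. \<Sum>j\<in>UNIV. pd k (U i) x * pd k (U j) x * w i j x)
      - 1/2 * (\<Sum>i\<in>UNIV. \<Sum>j\<in>UNIV. U i x * U j x * (\<Sum>k\<in>UNIV. pd k (dw k i j) x))
      + \<alpha> * ((\<Sum>l\<in>UNIV. pd l (U l) x) * (\<Sum>i\<in>UNIV. \<Sum>j\<in>UNIV. pd i (U j) x * w i j x + U j x * dw i i j x))
      + (\<Sum>k\<in>UNIV. pd k (weight_flux \<alpha> w dw U k) x)"
proof -
  have dU: "U i differentiable (at x)" "pd k (U i) differentiable (at x)" for i k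
    using u by (simp_all add: smooth_differentiable smooth_pd)
  have dW: "w i j differentiable (at x)" "dw k i j differentiable (at x)" for i j k
    using w x by (simp_all add: c1_off_differentiable)
  note L = lame_component[of U, OF u]
  have F: "pd k (weight_flux \<alpha> w dw U k) x = (\<Sum>i\<in>UNIV. \<Sum>j\<in>UNIV.
       (pd k (U i) x * U j x * dw k i j x + U i x * pd k (U j) x * dw k i j x + U i x * U j x * pd k (dw k i j) x) / 2
        - (pd k (pd k (U i)) x * U j x * w i j x + pd k (U i) x * pd k (U j) x * w i j x + pd k (U i) x * U j x * dw k i j x))
      - \<alpha> * ((\<Sum>l\<in>UNIV. pd k (pd l (U l)) x) * (\<Sum>j\<in>UNIV. U j x * w k j x)
           + (\<Sum>l\<in>UNIV. pd l (U l) x) * (\<Sum>j\<in>UNIV. pd k (U j) x * w k j x + U j x * dw k k j x))" for k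
    unfolding weight_flux_def[abs_def]
    by (simp add: pd_sum pd_mult pd_diff pd_const pd_divide_const dU dW dw[OF x] differentiable_mult differentiable_diff
        differentiable_sum) (simp add: algebra_simps)
  \<comment> \<open>Here the symmetry of the weight merges the two bilinear terms that the product
    rule creates.\<close>
  have cross: "(\<Sum>i\<in>UNIV. \<Sum>j\<in>UNIV. U i x * pd k (U j) x * dw k i j x)
      = (\<Sum>i\<in>UNIV. \<Sum>j\<in>UNIV. pd k (U i) x * U j x * dw k i j x)" for k
    by (subst sum.swap, intro sum.cong refl) (simp add: sym(2)[of k] mult.commute)
  have tw: "(\<Sum>l\<in>UNIV. pd k (pd l (U l)) x) * (\<Sum>j\<in>UNIV. U j x * w k j x)
      = (\<Sum>j\<in>UNIV. (\<Sum>l\<in>UNIV. pd k (pd l (U l)) x) * w k j x * U j x)" for k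
    by (subst sum_distrib_left) (simp add: mult_ac)
  have F': "pd k (weight_flux \<alpha> w dw U k) x = (\<Sum>i\<in>UNIV. \<Sum>j\<in>UNIV. U i x * U j x * pd k (dw k i j) x) / 2
      - (\<Sum>i\<in>UNIV. \<Sum>j\<in>UNIV. pd k (pd k (U i)) x * U j x * w i j x)
      - (\<Sum>i\<in>UNIV. \<Sum>j\<in>UNIV. pd k (U i) x * pd k (U j) x * w i j x)
      - \<alpha> * (\<Sum>j\<in>UNIV. (\<Sum>l\<in>UNIV. pd k (pd l (U l)) x) * w k j x * U j x)
      - \<alpha> * ((\<Sum>l\<in>UNIV. pd l (U l) x) * (\<Sum>j\<in>UNIV. pd k (U j) x * w k j x + U j x * dw k k j x))" for k
    unfolding F add_divide_distrib sum.distrib sum_subtractf sum_divide_distrib[symmetric] cross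
      distrib_left tw by simp
  have lhs: "(\<Sum>i\<in>UNIV. \<Sum>j\<in>UNIV. lame \<alpha> (\<lambda>y. \<chi> i. U i y) x $ i * w i j x * U j x)
    = - (\<Sum>k\<in>UNIV. \<Sum>i\<in>UNIV. \<Sum>j\<in>UNIV. pd k (pd k (U i)) x * U j x * w i j x)
      - \<alpha> * (\<Sum>i\<in>UNIV. \<Sum>j\<in>UNIV. (\<Sum>l\<in>UNIV. pd i (pd l (U l)) x) * w i j x * U j x)"
  proof -
    have "(\<Sum>i\<in>UNIV. \<Sum>j\<in>UNIV. lame \<alpha> (\<lambda>y. \<chi> i. U i y) x $ i * w i j x * U j x)
      = (\<Sum>i\<in>UNIV. \<Sum>j\<in>UNIV. - (\<Sum>k\<in>UNIV. pd k (pd k (U i)) x * U j x * w i j x)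
          - \<alpha> * ((\<Sum>l\<in>UNIV. pd i (pd l (U l)) x) * w i j x * U j x))"
      by (intro sum.cong refl) (simp only: L sum_distrib_right[symmetric], algebra)
    also have "\<dots> = - (\<Sum>i\<in>UNIV. \<Sum>j\<in>UNIV. \<Sum>k\<in>UNIV. pd k (pd k (U i)) x * U j x * w i j x)
      - \<alpha> * (\<Sum>i\<in>UNIV. \<Sum>j\<in>UNIV. (\<Sum>l\<in>UNIV. pd i (pd l (U l)) x) * w i j x * U j x)"
      by (simp only: sum_subtractf sum_negf sum_distrib_left)
    finally show ?thesis
      unfolding sum_rotate[where f = "\<lambda>i j k. pd k (pd k (U i)) x * U j x * w i j x"] .
  qed
  have d2: "(\<Sum>i\<in>UNIV. \<Sum>j\<in>UNIV. U i x * U j x * (\<Sum>k\<in>UNIV. pd k (dw k i j) x))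
     = (\<Sum>k\<in>UNIV. \<Sum>i\<in>UNIV. \<Sum>j\<in>UNIV. U i x * U j x * pd k (dw k i j) x)"
    unfolding sum_distrib_left by (rule sum_rotate)
  have "(\<Sum>k\<in>UNIV. pd k (weight_flux \<alpha> w dw U k) x) =
      (\<Sum>k\<in>UNIV. \<Sum>i\<in>UNIV. \<Sum>j\<in>UNIV. U i x * U j x * pd k (dw k i j) x) / 2
      - (\<Sum>k\<in>UNIV. \<Sum>i\<in>UNIV. \<Sum>j\<in>UNIV. pd k (pd k (U i)) x * U j x * w i j x)
      - (\<Sum>k\<in>UNIV. \<Sum>i\<in>UNIV. \<Sum>j\<in>UNIV. pd k (U i) x * pd k (U j) x * w i j x)
      - \<alpha> * (\<Sum>k\<in>UNIV. \<Sum>j\<in>UNIV. (\<Sum>l\<in>UNIV. pd k (pd l (U l)) x) * w k j x * U j x)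
      - \<alpha> * ((\<Sum>l\<in>UNIV. pd l (U l) x) * (\<Sum>k\<in>UNIV. \<Sum>j\<in>UNIV. pd k (U j) x * w k j x + U j x * dw k k j x))"
    unfolding F' sum_subtractf sum_divide_distrib by (simp only: sum_distrib_left)
  then show ?thesis
    unfolding lhs d2 by simp
qed

section \<open>The null Lagrangian and the derivatives of the Lame weight\<close>

definition rho :: "real^3 \<Rightarrow> real" where "rho x = 1 / norm x"

lemma rho_eq: "rho = (\<lambda>x. 1 / norm x)"
  by (simp add: rho_def fun_eq_iff)

lemma pd_rho: "x \<noteq> 0 \<Longrightarrow> pd k rho x = - (x $ k * rho x ^ 3)"
  unfolding rho_eq by (rule pd_norm_inverse)

lemma c1_off_rho: "c1_off rho"
  unfolding rho_eq by (rule c1_off_norm_inverse)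

text \<open>The one relation between \<open>rho\<close> and the coordinates, in the polynomial form
  that \<open>algebra\<close> can use.\<close>

lemma rho_sq:
  assumes "x \<noteq> 0"
  shows "(rho x)\<^sup>2 * (x $ 1 * x $ 1 + x $ 2 * x $ 2 + x $ 3 * x $ 3) = 1"
proof -
  have "(norm x)\<^sup>2 = x $ 1 * x $ 1 + x $ 2 * x $ 2 + x $ 3 * x $ 3"
    unfolding power2_norm_eq_inner by (simp add: inner_vec_def sum_3)
  then show ?thesis using assms by (simp add: rho_def power_divide flip: \<open>(norm x)\<^sup>2 = _\<close>)
qed

lemma rho_power5:
  assumes "x \<noteq> 0"
  shows "rho x ^ 5 * (x $ 1 * x $ 1 + x $ 2 * x $ 2 + x $ 3 * x $ 3) = rho x ^ 3"
  using rho_sq[OF assms] by algebra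

lemma differentiable_basic:
  assumes "x \<noteq> 0"
  shows "(\<lambda>x::real^3. x $ i) differentiable (at x)" "rho differentiable (at x)"
    "(\<lambda>x. rho x ^ n) differentiable (at x)"
  using assms by (auto intro!: c1_off_differentiable c1_off_intros c1_off_rho)

lemma pd_rho_powers:
  assumes "x \<noteq> 0"
  shows "pd k (\<lambda>x. rho x ^ 3) x = - (3 * x $ k * rho x ^ 5)"
    "pd k (\<lambda>x. rho x ^ 5) x = - (5 * x $ k * rho x ^ 7)"
  unfolding pd_power3[OF differentiable_basic(2)[OF assms]] pd_power5[OF differentiable_basic(2)[OF assms]]
    pd_rho[OF assms] by algebra+

text \<open>The weighted cofactor flux
  \<open>\<epsilon>\<^sub>m\<^sub>p\<^sub>q \<epsilon>\<^sub>n\<^sub>k\<^sub>i y\<^sub>m y\<^sub>n \<rho>\<^sup>3 U\<^sub>p \<partial>\<^sub>i U\<^sub>q\<close>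
  with the products of Levi-Civita symbols written out.\<close>

definition null_flux :: "(3 \<Rightarrow> real^3 \<Rightarrow> real) \<Rightarrow> 3 \<Rightarrow> real^3 \<Rightarrow> real" where
  "null_flux U k y = (let G = \<lambda>i j. pd i (U j) y; t = \<Sum>l\<in>UNIV. G l l; ux = \<Sum>l\<in>UNIV. U l y * y $ l;
      V = \<lambda>k. U k y * t - (\<Sum>i\<in>UNIV. U i y * G i k) in
      rho y * V k - rho y ^ 3 * y $ k * (\<Sum>j\<in>UNIV. V j * y $ j)
      + rho y ^ 3 * (ux * (\<Sum>i\<in>UNIV. y $ i * G i k) - U k y * (\<Sum>j\<in>UNIV. (\<Sum>i\<in>UNIV. y $ i * G i j) * y $ j)))"

text \<open>The flux is built from cofactors, so second derivatives of \<open>U\<close> enter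
  antisymmetrically and cancel by \<open>Hs\<close>. Differentiating the powers of
  \<open>rho\<close> contributes only multiples of \<open>S\<close>, and all but one of these
  cancel.\<close>

lemma null_lagrangian:
  assumes u: "\<And>i. smooth (U i)" and x: "x \<noteq> 0"
  shows "(\<Sum>k\<in>UNIV. pd k (null_flux U k) x) =
    (let G = \<lambda>i j. pd i (U j) x; t = \<Sum>l\<in>UNIV. G l l in
      rho x * (t\<^sup>2 - (\<Sum>i\<in>UNIV. \<Sum>j\<in>UNIV. G i j * G j i))
      - rho x ^ 3 * (\<Sum>j\<in>UNIV. (U j x * t - (\<Sum>i\<in>UNIV. U i x * G i j)) * x $ j)
      - 2 * rho x ^ 3 * (t * (\<Sum>i\<in>UNIV. \<Sum>j\<in>UNIV. x $ i * G i j * x $ j) -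
          (\<Sum>j\<in>UNIV. (\<Sum>i\<in>UNIV. x $ i * G i j) * (\<Sum>k\<in>UNIV. G j k * x $ k))))"
proof -
  define G where "G = (\<lambda>i j. pd i (U j))"
  define H where "H = (\<lambda>k i j. pd k (G i j) x)"
  have Hs: "H i j k = H j i k" for i j k
    using u by (simp add: H_def G_def smooth_pd_commute)
  have dU: "U i differentiable (at x)" "G k i differentiable (at x)" for i k
    using u by (simp_all add: smooth_differentiable smooth_pd G_def)
  note dx = differentiable_basic(1,2)[OF x] differentiable_basic(3)[OF x, of 3]
  note pr = pd_rho_powers(1)[OF x]
  define V where "V = (\<lambda>k y. U k y * (\<Sum>l\<in>UNIV. G l l y) - (\<Sum>i\<in>UNIV. U i y * G i k y))"
  define B where "B = (\<lambda>y. \<Sum>l\<in>UNIV. U l y * y $ l)"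
  define C where "C = (\<lambda>j y. \<Sum>i\<in>UNIV. y $ i * G i j y)"
  define A where "A = (\<lambda>y. \<Sum>j\<in>UNIV. C j y * y $ j)"
  define W where "W = (\<lambda>j y. B y * C j y - U j y * A y)"
  define S where "S = (\<lambda>y. \<Sum>j\<in>UNIV. V j y * y $ j)"
  have Y: "null_flux U k = (\<lambda>y. rho y * V k y - rho y ^ 3 * (y $ k * S y - W k y))" for k
    by (simp add: null_flux_def Let_def fun_eq_iff G_def V_def W_def A_def B_def C_def S_def algebra_simps)
  have pV: "pd k (V j) x = G k j x * (\<Sum>l\<in>UNIV. G l l x) + U j x * (\<Sum>l\<in>UNIV. H k l l)
      - (\<Sum>i\<in>UNIV. G k i x * G i j x + U i x * H k i j)" for k j
    unfolding V_def H_def by (simp add: pd_sum pd_mult pd_diff dU differentiable_mult differentiable_diff differentiable_sum)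
       (simp add: G_def)
  have dV: "V j differentiable (at x)" for j
    unfolding V_def by (simp add: dU differentiable_mult differentiable_diff differentiable_sum)
  have dS: "S differentiable (at x)"
    unfolding S_def by (simp add: dV dx differentiable_mult differentiable_sum)
  have pS: "pd k S x = (\<Sum>j\<in>UNIV. pd k (V j) x * x $ j) + V k x" for k
    unfolding S_def
    by (simp add: pd_sum pd_mult dV dx differentiable_mult pd_coord sum.distrib if_distrib[of "(*) _"] cong: if_cong)
  have dC: "C j differentiable (at x)" for j
    unfolding C_def by (simp add: dU dx differentiable_mult differentiable_sum)
  have dBA: "B differentiable (at x)" "A differentiable (at x)"
    unfolding A_def B_def by (simp_all add: dU dx dC differentiable_mult differentiable_sum)
  have dW: "W j differentiable (at x)" for j
    unfolding W_def by (simp add: dU dC dBA differentiable_mult differentiable_diff)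
  have pB: "pd k B x = (\<Sum>l\<in>UNIV. G k l x * x $ l) + U k x" for k
    unfolding B_def by (simp add: pd_sum pd_mult dU dx differentiable_mult pd_coord sum.distrib
       if_distrib[of "(*) _"] cong: if_cong) (simp add: G_def)
  have pC: "pd k (C j) x = G k j x + (\<Sum>i\<in>UNIV. x $ i * H k i j)" for k j
    unfolding C_def H_def by (simp add: pd_sum pd_mult dU dx differentiable_mult pd_coord sum.distrib
       if_distrib[of "\<lambda>z. z * _"] cong: if_cong)
  have pA: "pd k A x = (\<Sum>j\<in>UNIV. pd k (C j) x * x $ j) + C k x" for k
    unfolding A_def by (simp add: pd_sum pd_mult dC dx differentiable_mult pd_coord sum.distrib
       if_distrib[of "(*) _"] cong: if_cong)
  have pW: "pd k (W j) x = pd k B x * C j x + B x * pd k (C j) x - (G k j x * A x + U j x * pd k A x)" for k j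
    unfolding W_def by (simp add: pd_mult pd_diff dU dC dBA differentiable_mult) (simp add: G_def)
  have pdn: "pd k (null_flux U k) x = - (x $ k * rho x ^ 3) * V k x + rho x * pd k (V k) x
     + 3 * x $ k * rho x ^ 5 * (x $ k * S x - W k x) - rho x ^ 3 * (S x + x $ k * pd k S x - pd k (W k) x)" for k
    unfolding Y
    by (simp add: pd_mult pd_diff dV dW dS dx differentiable_mult differentiable_diff pd_coord pr pd_rho[OF x])
  have xV: "S x = V 1 x * x $ 1 + V 2 x * x $ 2 + V 3 x * x $ 3"
    by (simp add: S_def sum_3)
  have "(\<Sum>k\<in>UNIV. pd k (null_flux U k) x) =
     rho x * (\<Sum>k\<in>UNIV. pd k (V k) x) - rho x ^ 3 * S x
     + 3 * (rho x ^ 5 * (x $ 1 * x $ 1 + x $ 2 * x $ 2 + x $ 3 * x $ 3)) * S x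
     - 3 * rho x ^ 5 * (\<Sum>k\<in>UNIV. x $ k * W k x)
     - rho x ^ 3 * (3 * S x + ((\<Sum>k\<in>UNIV. x $ k * pd k S x) - (\<Sum>k\<in>UNIV. pd k (W k) x)))"
    unfolding sum_3 pdn xV by algebra
  \<comment> \<open>\<open>W\<close> is orthogonal to the radial direction, both of its terms
    contracting to \<open>B x * A x\<close>; hence the gradient of the cube of \<open>rho\<close>
    does not see it.\<close>
  also have "(\<Sum>k\<in>UNIV. x $ k * W k x) = 0"
    unfolding W_def A_def B_def C_def sum_3 by algebra
  also have "(\<Sum>k\<in>UNIV. pd k (V k) x) = (\<Sum>l\<in>UNIV. G l l x)\<^sup>2 - (\<Sum>i\<in>UNIV. \<Sum>j\<in>UNIV. G i j x * G j i x)"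
    unfolding pV sum_3 Hs[of 2 1] Hs[of 3 1] Hs[of 3 2] by algebra
  also have "(\<Sum>k\<in>UNIV. x $ k * pd k S x) - (\<Sum>k\<in>UNIV. pd k (W k) x) =
     2 * ((\<Sum>l\<in>UNIV. G l l x) * (\<Sum>i\<in>UNIV. \<Sum>j\<in>UNIV. x $ i * G i j x * x $ j) -
          (\<Sum>j\<in>UNIV. (\<Sum>i\<in>UNIV. x $ i * G i j x) * (\<Sum>k\<in>UNIV. G j k x * x $ k)))"
    unfolding pS pW unfolding pA pB unfolding pC pV unfolding V_def A_def B_def C_def
    unfolding sum_3 Hs[of 2 1] Hs[of 3 1] Hs[of 3 2] by algebra
  finally have eq: "(\<Sum>k\<in>UNIV. pd k (null_flux U k) x) =
      rho x * ((\<Sum>l\<in>UNIV. G l l x)\<^sup>2 - (\<Sum>i\<in>UNIV. \<Sum>j\<in>UNIV. G i j x * G j i x)) - rho x ^ 3 * S x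
      - 2 * rho x ^ 3 * ((\<Sum>l\<in>UNIV. G l l x) * (\<Sum>i\<in>UNIV. \<Sum>j\<in>UNIV. x $ i * G i j x * x $ j) -
          (\<Sum>j\<in>UNIV. (\<Sum>i\<in>UNIV. x $ i * G i j x) * (\<Sum>k\<in>UNIV. G j k x * x $ k)))"
    unfolding rho_power5[OF x] by algebra
  have Gx: "pd i (U j) x = G i j x" for i j
    by (simp add: G_def)
  show ?thesis
    unfolding Let_def Gx eq S_def V_def ..
qed

text \<open>The fundamental matrix without its factor \<open>c_lame \<alpha>\<close>, for
  \<open>\<kappa> = \<alpha> / (\<alpha> + 2)\<close>, as a polynomial in the coordinates and
  \<open>rho\<close>.\<close>

definition lame_weight :: "real \<Rightarrow> 3 \<Rightarrow> 3 \<Rightarrow> real^3 \<Rightarrow> real" where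
  "lame_weight \<kappa> i j y = (if i = j then 1 else 0) * rho y + \<kappa> * (y $ i * y $ j * rho y ^ 3)"

definition lame_weight_pd :: "real \<Rightarrow> 3 \<Rightarrow> 3 \<Rightarrow> 3 \<Rightarrow> real^3 \<Rightarrow> real" where
  "lame_weight_pd \<kappa> k i j y = - ((if i = j then 1 else 0) * (y $ k * rho y ^ 3))
    + \<kappa> * (((if i = k then 1 else 0) * y $ j + (if j = k then 1 else 0) * y $ i) * rho y ^ 3
      - 3 * (y $ i * y $ j * y $ k * rho y ^ 5))"

lemma lame_weight_sym: "lame_weight \<kappa> i j = lame_weight \<kappa> j i"
  "lame_weight_pd \<kappa> k i j = lame_weight_pd \<kappa> k j i"
  by (auto simp: lame_weight_def lame_weight_pd_def fun_eq_iff algebra_simps)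

lemma c1_off_lame_weight: "c1_off (lame_weight \<kappa> i j)" "c1_off (lame_weight_pd \<kappa> k i j)"
  unfolding lame_weight_def[abs_def] lame_weight_pd_def[abs_def]
  by (intro c1_off_intros c1_off_rho)+

lemma pd_lame_weight:
  assumes "x \<noteq> 0"
  shows "pd k (lame_weight \<kappa> i j) x = lame_weight_pd \<kappa> k i j x"
  unfolding lame_weight_def[abs_def] lame_weight_pd_def
  by (simp add: pd_add pd_mult pd_const pd_coord pd_rho[OF assms] pd_rho_powers[OF assms]
    differentiable_basic[OF assms] differentiable_mult)

lemma divergence_lame_weight:
  assumes "x \<noteq> 0"
  shows "(\<Sum>i\<in>UNIV. lame_weight_pd \<kappa> i i j x) = (\<kappa> - 1) * (x $ j * rho x ^ 3)"
proof -
  have "(\<Sum>i\<in>UNIV. lame_weight_pd \<kappa> i i j x) = - (x $ j * rho x ^ 3) + \<kappa> * (4 * (x $ j * rho x ^ 3)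
      - 3 * x $ j * (rho x ^ 5 * (x $ 1 * x $ 1 + x $ 2 * x $ 2 + x $ 3 * x $ 3)))"
    using exhaust_3[of j] by (auto simp: lame_weight_pd_def sum_3 algebra_simps)
  then show ?thesis
    unfolding rho_power5[OF assms] by algebra
qed

lemma laplacian_lame_weight:
  assumes "x \<noteq> 0"
  shows "(\<Sum>k\<in>UNIV. pd k (lame_weight_pd \<kappa> k i j) x)
    = \<kappa> * (2 * ((if i = j then 1 else 0) * rho x ^ 3) - 6 * (x $ i * x $ j * rho x ^ 5))"
proof -
  have r7: "rho x ^ 7 * (x $ 1 * x $ 1 + x $ 2 * x $ 2 + x $ 3 * x $ 3) = rho x ^ 5"
    using rho_sq[OF assms] by algebra
  have pd2: "pd k (lame_weight_pd \<kappa> k i j) x =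
      - ((if i = j then 1 else 0) * (rho x ^ 3 - 3 * x $ k * x $ k * rho x ^ 5))
      + \<kappa> * ((if i = k then 1 else 0) * ((if j = k then 1 else 0) * rho x ^ 3 - 3 * x $ j * x $ k * rho x ^ 5)
        + (if j = k then 1 else 0) * ((if i = k then 1 else 0) * rho x ^ 3 - 3 * x $ i * x $ k * rho x ^ 5)
        - 3 * ((if i = k then 1 else 0) * x $ j * x $ k * rho x ^ 5 + (if j = k then 1 else 0) * x $ i * x $ k * rho x ^ 5
            + x $ i * x $ j * rho x ^ 5 - 5 * x $ i * x $ j * x $ k * x $ k * rho x ^ 7))" for k
    unfolding lame_weight_pd_def[abs_def]
    by (simp add: pd_add pd_diff pd_uminus pd_mult pd_const pd_coord pd_rho[OF assms] pd_rho_powers[OF assms]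
      differentiable_basic[OF assms] differentiable_mult differentiable_add differentiable_diff algebra_simps)
  \<comment> \<open>The bracket free of \<kappa> vanishes since \<open>rho\<close> is harmonic off
    the origin; in the other one, -21 and 15 combine to -6 by \<open>r7\<close>.\<close>
  have "(\<Sum>k\<in>UNIV. pd k (lame_weight_pd \<kappa> k i j) x) = - ((if i = j then 1 else 0) * (3 * rho x ^ 3
        - 3 * (rho x ^ 5 * (x $ 1 * x $ 1 + x $ 2 * x $ 2 + x $ 3 * x $ 3))))
      + \<kappa> * (2 * ((if i = j then 1 else 0) * rho x ^ 3) - 21 * (x $ i * x $ j * rho x ^ 5)
        + 15 * x $ i * x $ j * (rho x ^ 7 * (x $ 1 * x $ 1 + x $ 2 * x $ 2 + x $ 3 * x $ 3)))"
    using exhaust_3[of i] exhaust_3[of j] by (auto simp: pd2 sum_3 algebra_simps)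
  then show ?thesis
    unfolding rho_power5[OF assms] r7 by algebra
qed

text \<open>After \<open>divergence_form\<close>, the terms with undifferentiated \<open>U\<close>
  carry the common factor -\<kappa>, and \<open>N\<close> is chosen to absorb them. Its first flux
  yields the terms quadratic in \<open>U\<close> together with bilinear ones; subtracting
  \<open>null_flux\<close> adjusts these to twice the trace term and leaves the weighted minor,
  which is the last bracket of \<open>gradient_form\<close>.\<close>

lemma lame_weight_identity:
  fixes \<alpha> :: real and U :: "3 \<Rightarrow> real^3 \<Rightarrow> real"
  defines "\<kappa> \<equiv> \<alpha> / (\<alpha> + 2)"
  defines "F \<equiv> weight_flux \<alpha> (lame_weight \<kappa>) (lame_weight_pd \<kappa>) U"
    and "N \<equiv> \<lambda>k y. U k y * (\<Sum>l\<in>UNIV. U l y * y $ l) * rho y ^ 3 - null_flux U k y"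
  assumes u: "\<And>i. smooth (U i)" and \<alpha>: "\<alpha> + 2 \<noteq> 0" and x: "x \<noteq> 0"
  shows "(\<Sum>i\<in>UNIV. \<Sum>j\<in>UNIV. lame \<alpha> (\<lambda>y. \<chi> i. U i y) x $ i * lame_weight \<kappa> i j x * U j x)
    = rho x * gradient_form \<alpha> (\<lambda>i. x $ i * rho x) (\<lambda>i j. pd i (U j) x)
      + (\<Sum>k\<in>UNIV. pd k (F k) x) - \<kappa> * (\<Sum>k\<in>UNIV. pd k (N k) x)"
proof -
  define G where "G = (\<lambda>i j. pd i (U j) x)"
  define t where "t = (\<Sum>l\<in>UNIV. G l l)"
  define r where "r = rho x"
  \<comment> \<open>This is the relation by which the operator annihilates the columns of the
    weight. It gives the divergence term the same factor \<kappa> as the Laplacian term.\<close>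
  have \<kappa>: "\<alpha> * (\<kappa> - 1) = - 2 * \<kappa>"
    using \<alpha> by (simp add: \<kappa>_def field_simps)
  have dU: "U i differentiable (at x)" for i
    using u by (simp add: smooth_differentiable)
  have dN: "null_flux U k differentiable (at x)" for k
    unfolding null_flux_def[abs_def] Let_def using u x
    by (intro c1_off_differentiable c1_off_intros c1_off_rho smooth_c1_off smooth_pd) auto
  have Gx: "pd i (U j) x = G i j" for i j
    by (simp add: G_def)
  have pN: "pd k (N k) x = (G k k * (\<Sum>l\<in>UNIV. U l x * x $ l) + U k x * ((\<Sum>l\<in>UNIV. G k l * x $ l) + U k x)) * r ^ 3
      - 3 * U k x * (\<Sum>l\<in>UNIV. U l x * x $ l) * (x $ k * r ^ 5) - pd k (null_flux U k) x" for k
    unfolding N_def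
    by (simp add: pd_diff pd_mult pd_sum pd_coord pd_rho_powers[OF x] dU dN differentiable_basic[OF x]
        differentiable_mult differentiable_diff differentiable_sum sum.distrib if_distrib[of "(*) _"] Gx r_def
        cong: if_cong)
  have N: "(\<Sum>k\<in>UNIV. pd k (N k) x) = (\<Sum>j\<in>UNIV. (U j x)\<^sup>2) * r ^ 3 - 3 * (\<Sum>l\<in>UNIV. U l x * x $ l)\<^sup>2 * r ^ 5
      + 2 * t * (\<Sum>l\<in>UNIV. U l x * x $ l) * r ^ 3
      - r * (t\<^sup>2 - (\<Sum>i\<in>UNIV. \<Sum>j\<in>UNIV. G i j * G j i))
      + 2 * r ^ 3 * (t * (\<Sum>i\<in>UNIV. \<Sum>j\<in>UNIV. x $ i * G i j * x $ j) -
          (\<Sum>j\<in>UNIV. (\<Sum>i\<in>UNIV. x $ i * G i j) * (\<Sum>k\<in>UNIV. G j k * x $ k)))"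
    unfolding pN sum_subtractf null_lagrangian[OF u x] Let_def Gx t_def r_def[symmetric] sum_3
    by algebra
  have lap: "U i x * U j x * (\<Sum>k\<in>UNIV. pd k (lame_weight_pd \<kappa> k i j) x) =
     2 * \<kappa> * (r ^ 3 * (U i x * (if i = j then U j x else 0)) - 3 * r ^ 5 * ((U i x * x $ i) * (U j x * x $ j)))" for i j
    unfolding laplacian_lame_weight[OF x] r_def by (simp add: algebra_simps)
  have D: "(\<Sum>i\<in>UNIV. \<Sum>j\<in>UNIV. U i x * U j x * (\<Sum>k\<in>UNIV. pd k (lame_weight_pd \<kappa> k i j) x))
      = 2 * \<kappa> * ((\<Sum>j\<in>UNIV. (U j x)\<^sup>2) * r ^ 3 - 3 * (\<Sum>l\<in>UNIV. U l x * x $ l)\<^sup>2 * r ^ 5)"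
    unfolding lap unfolding sum_3 by simp algebra
  have div: "(\<Sum>i\<in>UNIV. \<Sum>j\<in>UNIV. G i j * lame_weight \<kappa> i j x + U j x * lame_weight_pd \<kappa> i i j x)
      = (\<Sum>i\<in>UNIV. \<Sum>j\<in>UNIV. G i j * lame_weight \<kappa> i j x) + (\<kappa> - 1) * (\<Sum>l\<in>UNIV. U l x * x $ l) * r ^ 3"
  proof -
    have "(\<Sum>i\<in>UNIV. \<Sum>j\<in>UNIV. U j x * lame_weight_pd \<kappa> i i j x)
        = (\<Sum>j\<in>UNIV. U j x * (\<Sum>i\<in>UNIV. lame_weight_pd \<kappa> i i j x))"
      unfolding sum_distrib_left by (rule sum.swap)
    also have "\<dots> = (\<kappa> - 1) * (\<Sum>l\<in>UNIV. U l x * x $ l) * r ^ 3"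
      unfolding divergence_lame_weight[OF x] unfolding sum_3 r_def by algebra
    finally show ?thesis by (simp add: sum.distrib)
  qed
  have A1: "(\<Sum>k\<in>UNIV. \<Sum>i\<in>UNIV. \<Sum>j\<in>UNIV. G k i * G k j * lame_weight \<kappa> i j x)
      = r * ((\<Sum>k\<in>UNIV. \<Sum>i\<in>UNIV. (G k i)\<^sup>2) + \<kappa> * (\<Sum>k\<in>UNIV. (\<Sum>i\<in>UNIV. G k i * (x $ i * r))\<^sup>2))"
    unfolding lame_weight_def r_def[symmetric] sum_3 by simp algebra
  have A2: "(\<Sum>i\<in>UNIV. \<Sum>j\<in>UNIV. G i j * lame_weight \<kappa> i j x)
      = r * (t + \<kappa> * (\<Sum>i\<in>UNIV. \<Sum>j\<in>UNIV. (x $ i * r) * G i j * (x $ j * r)))"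
    unfolding lame_weight_def r_def[symmetric] t_def sum_3 by simp algebra
  have M: "r * (2 * (\<Sum>i\<in>UNIV. \<Sum>j\<in>UNIV. (x $ i * r) * G i j * (x $ j * r)) * t
        - 2 * (\<Sum>j\<in>UNIV. (\<Sum>i\<in>UNIV. (x $ i * r) * G i j) * (\<Sum>k\<in>UNIV. G j k * (x $ k * r))))
      = 2 * r ^ 3 * (t * (\<Sum>i\<in>UNIV. \<Sum>j\<in>UNIV. x $ i * G i j * x $ j) -
          (\<Sum>j\<in>UNIV. (\<Sum>i\<in>UNIV. x $ i * G i j) * (\<Sum>k\<in>UNIV. G j k * x $ k)))"
    unfolding sum_3 by algebra
  note form = divergence_form[where w = "lame_weight \<kappa>" and dw = "lame_weight_pd \<kappa>" and U = U and \<alpha> = \<alpha>,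
      OF u lame_weight_sym c1_off_lame_weight pd_lame_weight x]
  have "(\<Sum>i\<in>UNIV. \<Sum>j\<in>UNIV. lame \<alpha> (\<lambda>y. \<chi> i. U i y) x $ i * lame_weight \<kappa> i j x * U j x)
      = (\<Sum>k\<in>UNIV. \<Sum>i\<in>UNIV. \<Sum>j\<in>UNIV. G k i * G k j * lame_weight \<kappa> i j x)
        - 1 / 2 * (\<Sum>i\<in>UNIV. \<Sum>j\<in>UNIV. U i x * U j x * (\<Sum>k\<in>UNIV. pd k (lame_weight_pd \<kappa> k i j) x))
        + \<alpha> * (t * (\<Sum>i\<in>UNIV. \<Sum>j\<in>UNIV. G i j * lame_weight \<kappa> i j x + U j x * lame_weight_pd \<kappa> i i j x))
        + (\<Sum>k\<in>UNIV. pd k (F k) x)"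
    using form unfolding Gx t_def F_def .
  then show ?thesis
    unfolding D div A1 A2 N gradient_form_def Let_def \<kappa>_def[symmetric] Gx t_def[symmetric] r_def[symmetric]
    using \<kappa> M by algebra
qed

section \<open>Positivity by integration of the identity\<close>

lemma lame_fundamental_matrix_integrand:
  "lame \<alpha> u x \<bullet> (fundamental_matrix \<alpha> x *v v) = c_lame \<alpha> *
    (\<Sum>i\<in>UNIV. \<Sum>j\<in>UNIV. lame \<alpha> u x $ i * lame_weight (\<alpha> / (\<alpha> + 2)) i j x * v $ j)"
proof -
  have "fundamental_matrix \<alpha> x $ i $ j = c_lame \<alpha> * lame_weight (\<alpha> / (\<alpha> + 2)) i j x" for i j
    by (simp add: fundamental_matrix_def lame_weight_def rho_def power3_eq_cube distrib_left mult_ac)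
  then show ?thesis
    by (simp add: inner_vec_def matrix_vector_mult_def sum_distrib_left mult_ac)
qed

lemma continuous_gradient_form:
  assumes "\<And>i. smooth (U i)"
  shows "continuous_on (-{0}) (\<lambda>x. rho x * gradient_form \<alpha> (\<lambda>i. x $ i * rho x) (\<lambda>i j. pd i (U j) x))"
  unfolding gradient_form_def Let_def
  by (intro c1_off_continuous c1_off_intros c1_off_rho smooth_c1_off smooth_pd assms)

lemma test_fun_support:
  assumes "\<And>i::3. test_fun (U i)"
  obtains K where "compact K" "0 \<notin> K" "\<And>i x. x \<notin> K \<Longrightarrow> U i x = 0"
proof
  let ?K = "\<Union>i. supp (U i)"
  show "compact ?K" using assms by (intro compact_UN) (auto simp: test_fun_def)
  show "0 \<notin> ?K" using assms by (auto simp: test_fun_def)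
  show "U i x = 0" if "x \<notin> ?K" for i x
    using that closure_subset[of "{x. U i x \<noteq> 0}"] by (auto simp: supp_def)
qed

text \<open>The fluxes \<open>F\<close> and \<open>N\<close> vanish off \<open>K\<close>, so their
  divergences integrate to zero and the form equals \<open>c_lame \<alpha>\<close> times the
  integral of \<open>Q\<close>, both factors being nonnegative.\<close>

lemma lame_pos_def:
  assumes \<alpha>: "-0.3 \<le> \<alpha>" "\<alpha> \<le> 2"
  shows "pos_def_with_weight (lame \<alpha>) (fundamental_matrix \<alpha>)"
  unfolding pos_def_with_weight_def
proof (intro allI impI)
  fix u :: "real^3 \<Rightarrow> real^3"
  assume test: "\<forall>i. test_fun (\<lambda>x. u x $ i)"
  define U where "U = (\<lambda>i y. u y $ i)"
  define \<kappa> where "\<kappa> = \<alpha> / (\<alpha> + 2)"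
  define F where "F = weight_flux \<alpha> (lame_weight \<kappa>) (lame_weight_pd \<kappa>) U"
  define N where "N = (\<lambda>k y. U k y * (\<Sum>l\<in>UNIV. U l y * y $ l) * rho y ^ 3 - null_flux U k y)"
  define Q where "Q = (\<lambda>x. rho x * gradient_form \<alpha> (\<lambda>i. x $ i * rho x) (\<lambda>i j. pd i (U j) x))"
  have sm: "smooth (U i)" for i
    using test by (simp add: U_def test_fun_def)
  obtain K where K: "compact K" "0 \<notin> K" and U0: "\<And>i x. x \<notin> K \<Longrightarrow> U i x = 0"
    using test_fun_support[of U] test unfolding U_def by metis
  have pd0: "pd k (U i) x = 0" if "x \<notin> K" for k i x
    using pd_eq_0_off_closed[of K "U i"] K U0 that by (simp add: compact_imp_closed)
  have F: "c1_off (F k)" "\<And>x. x \<notin> K \<Longrightarrow> F k x = 0" for k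
    unfolding F_def weight_flux_def[abs_def]
    by (intro c1_off_intros c1_off_lame_weight smooth_c1_off smooth_pd sm) (simp add: U0 pd0)
  have N: "c1_off (N k)" "\<And>x. x \<notin> K \<Longrightarrow> N k x = 0" for k
    unfolding N_def null_flux_def[abs_def] Let_def
    by (intro c1_off_intros c1_off_rho smooth_c1_off smooth_pd sm) (simp add: U0 pd0)
  note intF = integral_pd_c1_off[OF F(1) K F(2)] and intN = integral_pd_c1_off[OF N(1) K N(2)]
  have Q0: "Q x = 0" if "x \<notin> K" for x
    using pd0[OF that] by (simp add: Q_def gradient_form_def)
  have intQ: "integrable lborel Q"
    using continuous_gradient_form[OF sm] K Q0 unfolding Q_def by (rule integrable_if_0_off)
  \<comment> \<open>At the origin \<open>rho\<close> takes the default value 0, so \<open>Q\<close>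
    vanishes there.\<close>
  have "Q x \<ge> 0" for x
  proof (cases "x = 0")
    case False
    have "(\<Sum>i\<in>UNIV. (x $ i * rho x)\<^sup>2) = 1"
      unfolding sum_3 using rho_sq[OF False] by algebra
    then show ?thesis
      unfolding Q_def using gradient_form_nonneg[OF \<alpha>] by (simp add: rho_def)
  qed (simp add: Q_def rho_def)
  then have posQ: "(LINT x|lborel. Q x) \<ge> 0" by simp
  have closed: "closed K" using K by (simp add: compact_imp_closed)
  \<comment> \<open>The identity requires a point off the origin; at the origin both sides are 0
    because \<open>K\<close> avoids it.\<close>
  have eq: "lame \<alpha> u x \<bullet> (fundamental_matrix \<alpha> x *v u x)
      = c_lame \<alpha> * (Q x + (\<Sum>k\<in>UNIV. pd k (F k) x) - \<kappa> * (\<Sum>k\<in>UNIV. pd k (N k) x))" for x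
  proof (cases "x = 0")
    case True
    have "u 0 = 0" using U0[OF K(2)] by (simp add: U_def vec_eq_iff)
    with True have "u x = 0" by simp
    moreover have "pd k (F k) x = 0" "pd k (N k) x = 0" for k
      using True K(2) pd_eq_0_off_closed[OF closed F(2)] pd_eq_0_off_closed[OF closed N(2)] by simp_all
    ultimately show ?thesis
      using Q0[of x] K(2) True by simp
  next
    case False
    have "(\<lambda>y. \<chi> i. U i y) = u" by (simp add: U_def)
    then show ?thesis
      using lame_weight_identity[of U \<alpha> x] sm \<alpha> False
      by (simp add: lame_fundamental_matrix_integrand F_def N_def Q_def \<kappa>_def U_def)
  qed
  have "(LINT x|lborel. lame \<alpha> u x \<bullet> (fundamental_matrix \<alpha> x *v u x)) = c_lame \<alpha> * (LINT x|lborel. Q x)"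
    unfolding eq by (simp add: intF intN intQ)
  also have "\<dots> \<ge> 0"
    using posQ \<alpha> by (intro mult_nonneg_nonneg) (simp_all add: c_lame_def)
  finally show "(LINT x|lborel. lame \<alpha> u x \<bullet> (fundamental_matrix \<alpha> x *v u x)) \<ge> 0" .
qed

subsection \<open>Smooth bump functions\<close>

text \<open>The algebra generated by \<open>A\<close>. If the partial derivatives of the generators
  stay in it, the sum and product rules keep all iterated derivatives in it, which gives
  smoothness.\<close>

inductive generated :: "(real^3 \<Rightarrow> real) set \<Rightarrow> (real^3 \<Rightarrow> real) \<Rightarrow> bool" for A where
  base: "f \<in> A \<Longrightarrow> generated A f"
| const: "generated A (\<lambda>x. c)"
| add: "generated A f \<Longrightarrow> generated A g \<Longrightarrow> generated A (\<lambda>x. f x + g x)"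
| mult: "generated A f \<Longrightarrow> generated A g \<Longrightarrow> generated A (\<lambda>x. f x * g x)"

lemma generated_smooth:
  assumes diff: "\<And>f x. f \<in> A \<Longrightarrow> f differentiable (at x)"
    and pd: "\<And>f k. f \<in> A \<Longrightarrow> generated A (pd k f)" and f: "generated A f"
  shows "smooth f"
proof -
  have step: "(\<forall>x. f differentiable (at x)) \<and> (\<forall>k. generated A (pd k f))" if "generated A f" for f
    using that
  proof induction
    case (base f)
    then show ?case using diff pd by blast
  next
    case (const c)
    have "pd k (\<lambda>x. c) = (\<lambda>x. 0)" for k by (simp add: fun_eq_iff pd_const)
    then show ?case by (simp add: generated.const)
  next
    case (add f g)
    then have "pd k (\<lambda>x. f x + g x) = (\<lambda>x. pd k f x + pd k g x)" for k
      by (simp add: fun_eq_iff pd_add)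
    with add show ?case by (simp add: generated.add)
  next
    case (mult f g)
    then have "pd k (\<lambda>x. f x * g x) = (\<lambda>x. pd k f x * g x + f x * pd k g x)" for k
      by (simp add: fun_eq_iff pd_mult)
    with mult show ?case by (simp add: generated.add generated.mult differentiable_mult)
  qed
  have "generated A (foldr pd ks f)" for ks
    using f by (induction ks) (auto dest: step)
  then show ?thesis
    using step by (auto simp: smooth_def differentiable_on_def intro: differentiable_at_withinI)
qed

text \<open>The set of all smooth functions is itself closed under \<open>pd\<close>, so it can
  serve as generating set; closure of smoothness under sums and products follows.\<close>

lemma smooth_generated:
  assumes "\<And>f. f \<in> A \<Longrightarrow> smooth f" "generated A f"
  shows "smooth f"
proof -
  have "generated (Collect smooth) f"
    using assms(2) by induction (auto intro: generated.intros assms(1))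
  then show ?thesis
    by (rule generated_smooth[rotated 2]) (auto intro: generated.base smooth_differentiable smooth_pd)
qed

lemma smooth_const: "smooth (\<lambda>x. c)"
  by (rule smooth_generated[of "{}"]) (auto intro: generated.intros)

lemma smooth_add: "smooth f \<Longrightarrow> smooth g \<Longrightarrow> smooth (\<lambda>x. f x + g x)"
  by (rule smooth_generated[of "{f, g}"]) (auto intro: generated.intros)

lemma smooth_mult: "smooth f \<Longrightarrow> smooth g \<Longrightarrow> smooth (\<lambda>x. f x * g x)"
  by (rule smooth_generated[of "{f, g}"]) (auto intro: generated.intros)

lemma smooth_coord: "smooth (\<lambda>x. x $ i)"
proof (rule generated_smooth[of "{\<lambda>x. x $ i}"])
  have "pd k (\<lambda>x. x $ i) = (\<lambda>x. if i = k then 1 else 0)" for k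
    by (simp add: fun_eq_iff pd_coord)
  then show "generated {\<lambda>x. x $ i} (pd k f)" if "f \<in> {\<lambda>x. x $ i}" for f k
    using that by (auto intro: generated.const)
  show "f differentiable (at x)" if "f \<in> {\<lambda>x. x $ i}" for f and x :: "real^3"
    using that bounded_linear_imp_differentiable[OF bounded_linear_vec_nth[of i]] by auto
qed (auto intro: generated.base)

lemma chain_differentiable:
  fixes g :: "real^3 \<Rightarrow> real"
  assumes "(h has_real_derivative h') (at (g x))" "g differentiable (at x)"
  shows "(\<lambda>x. h (g x)) differentiable (at x)" "pd k (\<lambda>x. h (g x)) x = h' * pd k g x"
proof -
  obtain g' where g: "(g has_derivative g') (at x)"
    using assms by (auto simp: differentiable_def)
  have d: "((\<lambda>x. h (g x)) has_derivative (\<lambda>y. h' * g' y)) (at x)"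
    using has_derivative_compose[OF g assms(1)[unfolded has_field_derivative_def]] .
  show "(\<lambda>x. h (g x)) differentiable (at x)"
    using d by (auto simp: differentiable_def)
  show "pd k (\<lambda>x. h (g x)) x = h' * pd k g x"
    by (simp add: pd_eqI[OF d] pd_eqI[OF g])
qed

text \<open>The classical flat function is the case \<open>n = 0\<close>. Dividing by powers of
  \<open>t\<close> makes the family closed under differentiation up to linear combinations.\<close>

definition flat_exp :: "nat \<Rightarrow> real \<Rightarrow> real" where
  "flat_exp n t = (if t > 0 then exp (- 1 / t) / t ^ n else 0)"

text \<open>From the right, the substitution \<open>s = 1 / t\<close> reduces this to the decay of
  \<open>s ^ n / exp s\<close> at infinity.\<close>

lemma flat_exp_tendsto_0: "(flat_exp n \<longlongrightarrow> 0) (at 0)"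
proof -
  have "((\<lambda>s::real. s ^ n / exp s) \<longlongrightarrow> 0) at_top"
    by (rule tendsto_power_div_exp_0)
  then have "((\<lambda>t::real. inverse t ^ n / exp (inverse t)) \<longlongrightarrow> 0) (at_right 0)"
    by (rule filterlim_compose) (rule filterlim_inverse_at_top_right)
  moreover have "\<forall>\<^sub>F t in at_right 0. inverse t ^ n / exp (inverse t) = flat_exp n t"
    by (rule eventually_at_right_less[THEN eventually_mono])
      (simp add: flat_exp_def exp_minus field_simps)
  ultimately have "(flat_exp n \<longlongrightarrow> 0) (at_right 0)"
    by (rule Lim_transform_eventually)
  moreover have "(flat_exp n \<longlongrightarrow> 0) (at_left 0)"
    by (rule tendsto_eventually) (auto simp: eventually_at_left_field flat_exp_def intro!: exI[of _ "-1"])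
  ultimately show ?thesis by (simp add: filterlim_at_split)
qed

lemma flat_exp_deriv:
  "(flat_exp n has_real_derivative flat_exp (n + 2) t - real n * flat_exp (n + 1) t) (at t)"
proof -
  consider "t < 0" | "t = 0" | "t > 0" by linarith
  then show ?thesis
  proof cases
    case 1
    have "(flat_exp n has_real_derivative 0) (at t)"
      by (rule has_field_derivative_transform_within_open[of "\<lambda>_. 0" _ _ "{..<0}"])
        (use 1 in \<open>auto simp: flat_exp_def\<close>)
    then show ?thesis using 1 by (simp add: flat_exp_def)
  next
    case 2
    \<comment> \<open>At 0 the difference quotient of \<open>flat_exp n\<close> is
      \<open>flat_exp (n + 1)\<close>, which tends to 0.\<close>
    have "((\<lambda>h. (flat_exp n (0 + h) - flat_exp n 0) / h) \<longlongrightarrow> 0) (at 0)"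
      by (rule Lim_transform_eventually[OF flat_exp_tendsto_0[of "n + 1"]])
        (auto simp: flat_exp_def eventually_at intro!: exI[of _ 1])
    then show ?thesis using 2 by (simp add: DERIV_def flat_exp_def)
  next
    case 3
    have "((\<lambda>t. exp (- 1 / t) * inverse t ^ n) has_real_derivative
        flat_exp (n + 2) t - real n * flat_exp (n + 1) t) (at t)"
    proof (cases n)
      case (Suc m)
      have "t ^ m = t * t ^ (m - Suc 0) \<or> m = 0"
        by (cases m) auto
      then show ?thesis
        using 3 Suc by (auto intro!: derivative_eq_intros simp: flat_exp_def field_simps power2_eq_square)
    qed (use 3 in \<open>auto intro!: derivative_eq_intros simp: flat_exp_def field_simps power2_eq_square\<close>)
    then show ?thesis
      by (rule has_field_derivative_transform_within_open[of _ _ _ "{0<..}"])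
        (use 3 in \<open>auto simp: flat_exp_def field_simps\<close>)
  qed
qed

lemma smooth_flat_exp:
  assumes "smooth g"
  shows "smooth (\<lambda>x. flat_exp n (g x))"
proof (rule generated_smooth[of "range (\<lambda>n x. flat_exp n (g x)) \<union> Collect smooth"])
  note chain = chain_differentiable[OF flat_exp_deriv smooth_differentiable[OF assms]]
  let ?A = "range (\<lambda>n x. flat_exp n (g x)) \<union> Collect smooth"
  have pd: "pd k (\<lambda>x. flat_exp n (g x))
      = (\<lambda>x. (flat_exp (n + 2) (g x) + (- real n) * flat_exp (n + 1) (g x)) * pd k g x)" for n k
    by (simp add: fun_eq_iff chain)
  have "generated ?A (pd k (\<lambda>x. flat_exp n (g x)))" for n k
    unfolding pd by (intro generated.mult generated.add generated.const; rule generated.base)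
      (use smooth_pd[OF assms] in auto)
  then show "generated ?A (pd k f)" if "f \<in> ?A" for f k
    using that by (auto intro: generated.base smooth_pd)
  show "f differentiable (at x)" if "f \<in> ?A" for f x
    using that chain(1) smooth_differentiable by auto
qed (auto intro: generated.base)

lemma smooth_sin_cos:
  assumes "smooth g"
  shows "smooth (\<lambda>x. cos (g x))" "smooth (\<lambda>x. sin (g x))"
    "pd k (\<lambda>x. cos (g x)) x = - sin (g x) * pd k g x" "pd k (\<lambda>x. sin (g x)) x = cos (g x) * pd k g x"
proof -
  note cs = chain_differentiable[OF DERIV_cos smooth_differentiable[OF assms]]
    chain_differentiable[OF DERIV_sin smooth_differentiable[OF assms]]
  show "pd k (\<lambda>x. cos (g x)) x = - sin (g x) * pd k g x" "pd k (\<lambda>x. sin (g x)) x = cos (g x) * pd k g x"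
    by (simp_all add: cs)
  let ?A = "{\<lambda>x. cos (g x), \<lambda>x. sin (g x)} \<union> Collect smooth"
  have pd: "pd k (\<lambda>x. cos (g x)) = (\<lambda>x. (-1) * sin (g x) * pd k g x)"
    "pd k (\<lambda>x. sin (g x)) = (\<lambda>x. cos (g x) * pd k g x)" for k
    by (simp_all add: fun_eq_iff cs)
  have gen: "generated ?A (\<lambda>x. cos (g x))" "generated ?A (\<lambda>x. sin (g x))" "generated ?A (pd k g)" for k
    using smooth_pd[OF assms] by (auto intro!: generated.base)
  have "generated ?A (pd k (\<lambda>x. cos (g x)))" "generated ?A (pd k (\<lambda>x. sin (g x)))" for k
    unfolding pd by (rule generated.mult[OF generated.mult[OF generated.const gen(2)] gen(3)],
      rule generated.mult[OF gen(1) gen(3)])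
  then have pdA: "generated ?A (pd k f)" if "f \<in> ?A" for f k
    using that by (auto intro: generated.base smooth_pd)
  have dA: "f differentiable (at x)" if "f \<in> ?A" for f x
    using that cs smooth_differentiable by auto
  show "smooth (\<lambda>x. cos (g x))" "smooth (\<lambda>x. sin (g x))"
    using generated_smooth[of ?A, OF dA pdA] gen(1,2) by blast+
qed

section \<open>Oscillating fields and the failure of positivity\<close>

lemma lame_scalar:
  assumes "smooth f"
  shows "lame \<alpha> (\<lambda>y. \<chi> i. a i * f y) x $ i
    = - a i * (\<Sum>k\<in>UNIV. pd k (pd k f) x) - \<alpha> * (\<Sum>k\<in>UNIV. a k * pd i (pd k f) x)"
proof -
  have d: "f differentiable (at x)" "pd k f differentiable (at x)" for k x
    using assms by (simp_all add: smooth_differentiable smooth_pd)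
  have s: "pd k (\<lambda>y. c * f y) = (\<lambda>y. c * pd k f y)" for c k
    by (simp add: fun_eq_iff pd_mult pd_const d)
  have "pd l (\<lambda>y. c * pd k f y) x = c * pd l (pd k f) x" for c k l
    by (simp add: pd_mult pd_const d)
  then show ?thesis
    by (simp add: lame_component smooth_mult smooth_const assms s sum_distrib_left sum_negf)
qed

text \<open>The terms of first order in the frequency \<open>N\<close> cancel between the two phases.\<close>

lemma lame_oscillation:
  fixes \<xi> :: "3 \<Rightarrow> real"
  assumes b: "smooth b" and l: "smooth l" "\<And>k x. pd k l x = N * \<xi> k"
  shows "lame \<alpha> (\<lambda>y. \<chi> i. a i * (b y * cos (l y))) x $ i * (b x * cos (l x))
      + lame \<alpha> (\<lambda>y. \<chi> i. a i * (b y * sin (l y))) x $ i * (b x * sin (l x))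
    = lame \<alpha> (\<lambda>y. \<chi> i. a i * b y) x $ i * b x
      + N\<^sup>2 * ((\<Sum>k\<in>UNIV. (\<xi> k)\<^sup>2) * a i + \<alpha> * \<xi> i * (\<Sum>k\<in>UNIV. \<xi> k * a k)) * (b x)\<^sup>2"
proof -
  define C where "C = (\<lambda>y. cos (l y))"
  define S where "S = (\<lambda>y. sin (l y))"
  have sm: "smooth C" "smooth S"
    unfolding C_def S_def using smooth_sin_cos[OF l(1)] by simp_all
  have pCS: "pd k C y = - (N * \<xi> k * S y)" "pd k S y = N * \<xi> k * C y" for k y
    unfolding C_def S_def smooth_sin_cos[OF l(1)] l(2) by simp_all
  have CS: "C x * C x + S x * S x = 1"
    by (simp add: C_def S_def flip: power2_eq_square)
  have d: "C differentiable (at y)" "S differentiable (at y)" "b differentiable (at y)"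
      "pd k b differentiable (at y)" for k y
    using sm b by (simp_all add: smooth_differentiable smooth_pd)
  have p1: "pd k (\<lambda>y. b y * C y) = (\<lambda>y. pd k b y * C y - N * \<xi> k * (b y * S y))"
    "pd k (\<lambda>y. b y * S y) = (\<lambda>y. pd k b y * S y + N * \<xi> k * (b y * C y))" for k
    by (simp_all add: fun_eq_iff pd_mult d pCS)
  have p2: "pd j (pd k (\<lambda>y. b y * C y)) x = pd j (pd k b) x * C x
       - N * (\<xi> j * pd k b x + \<xi> k * pd j b x) * S x - N\<^sup>2 * \<xi> j * \<xi> k * b x * C x"
    "pd j (pd k (\<lambda>y. b y * S y)) x = pd j (pd k b) x * S x
       + N * (\<xi> j * pd k b x + \<xi> k * pd j b x) * C x - N\<^sup>2 * \<xi> j * \<xi> k * b x * S x" for j k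
    unfolding p1 by (simp_all add: pd_mult pd_diff pd_add pd_const d pCS differentiable_mult
        power2_eq_square algebra_simps)
  have q: "pd j (pd k (\<lambda>y. b y * C y)) x * C x + pd j (pd k (\<lambda>y. b y * S y)) x * S x
      = pd j (pd k b) x - N\<^sup>2 * \<xi> j * \<xi> k * b x" for j k
    unfolding p2 using CS by algebra
  have "lame \<alpha> (\<lambda>y. \<chi> i. a i * (b y * C y)) x $ i * (b x * C x)
      + lame \<alpha> (\<lambda>y. \<chi> i. a i * (b y * S y)) x $ i * (b x * S x)
    = b x * (- a i * (\<Sum>k\<in>UNIV. pd k (pd k (\<lambda>y. b y * C y)) x * C x + pd k (pd k (\<lambda>y. b y * S y)) x * S x)
      - \<alpha> * (\<Sum>k\<in>UNIV. a k * (pd i (pd k (\<lambda>y. b y * C y)) x * C x + pd i (pd k (\<lambda>y. b y * S y)) x * S x)))"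
    unfolding lame_scalar[OF smooth_mult[OF b sm(1)]] lame_scalar[OF smooth_mult[OF b sm(2)]] sum_3
    by algebra
  also have "\<dots> = lame \<alpha> (\<lambda>y. \<chi> i. a i * b y) x $ i * b x
      + N\<^sup>2 * ((\<Sum>k\<in>UNIV. (\<xi> k)\<^sup>2) * a i + \<alpha> * \<xi> i * (\<Sum>k\<in>UNIV. \<xi> k * a k)) * (b x)\<^sup>2"
    unfolding q lame_scalar[OF b] unfolding sum_3 by algebra
  finally have "lame \<alpha> (\<lambda>y. \<chi> i. a i * (b y * C y)) x $ i * (b x * C x)
      + lame \<alpha> (\<lambda>y. \<chi> i. a i * (b y * S y)) x $ i * (b x * S x)
    = lame \<alpha> (\<lambda>y. \<chi> i. a i * b y) x $ i * b x
      + N\<^sup>2 * ((\<Sum>k\<in>UNIV. (\<xi> k)\<^sup>2) * a i + \<alpha> * \<xi> i * (\<Sum>k\<in>UNIV. \<xi> k * a k)) * (b x)\<^sup>2" .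
  then show ?thesis by (simp only: C_def S_def)
qed

text \<open>Near \<open>x0\<close> the function exceeds \<open>f x0 / 2\<close> on a ball of
  positive measure.\<close>

lemma integral_pos_if_continuous:
  fixes f :: "real^3 \<Rightarrow> real"
  assumes int: "integrable lborel f" and nonneg: "\<And>x. f x \<ge> 0" and cont: "isCont f x0" and pos: "f x0 > 0"
  shows "(LINT x|lborel. f x) > 0"
proof -
  have "\<forall>\<^sub>F x in nhds x0. f x > f x0 / 2"
    using cont pos by (intro order_tendstoD(1)[of f "f x0"]) (auto simp: isCont_def tendsto_at_iff_tendsto_nhds)
  then obtain d where d: "d > 0" "\<And>x. dist x x0 < d \<Longrightarrow> f x > f x0 / 2"
    by (auto simp: eventually_nhds_metric)
  have i: "integrable lborel (\<lambda>x. f x0 / 2 * indicator (ball x0 d) x)"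
    by (intro integrable_mult_right integrable_real_indicator) (auto simp: emeasure_lborel_ball_finite[unfolded infinity_ennreal_def])
  have "0 < f x0 / 2 * measure lborel (ball x0 d)"
    using pos d content_ball_pos[of d x0] by simp
  also have "\<dots> = (LINT x|lborel. f x0 / 2 * indicator (ball x0 d) x)"
    by simp
  also have "\<dots> \<le> (LINT x|lborel. f x)"
    using nonneg d(2) by (intro integral_mono i int) (auto simp: indicator_def dist_commute intro: less_imp_le)
  finally show ?thesis .
qed

text \<open>Ensures that the integrals for the two phases can be added.\<close>

lemma integrable_lame_form:
  assumes test: "\<And>i. test_fun (U i)"
  shows "integrable lborel (\<lambda>x. lame \<alpha> (\<lambda>y. \<chi> i. U i y) x \<bullet> (fundamental_matrix \<alpha> x *v (\<chi> i. U i x)))"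
proof -
  have sm: "smooth (U i)" for i
    using test by (simp add: test_fun_def)
  obtain K where K: "compact K" "0 \<notin> K" and U0: "\<And>i x. x \<notin> K \<Longrightarrow> U i x = 0"
    using test_fun_support[of U] test by metis
  show ?thesis
    unfolding lame_fundamental_matrix_integrand lame_component[of U, OF sm] vec_lambda_beta
    by (rule integrable_if_0_off[OF _ K])
      (intro c1_off_continuous c1_off_intros c1_off_lame_weight smooth_c1_off smooth_pd sm, simp add: U0)
qed

lemma test_fun_if_0_off_cball:
  assumes "smooth f" "\<And>x. f x \<noteq> 0 \<Longrightarrow> x \<in> cball z d" "0 \<notin> cball z d"
  shows "test_fun f"
proof -
  have sub: "supp f \<subseteq> cball z d"
    unfolding supp_def using assms(2) by (intro closure_minimal) auto
  then have "compact (supp f)"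
    using bounded_subset[OF bounded_cball] by (auto simp: compact_eq_bounded_closed supp_def)
  then show ?thesis
    using sub assms by (auto simp: test_fun_def)
qed

text \<open>The expression is the value of the symbol form at the amplitude used below.\<close>

lemma symbol_negative:
  fixes \<alpha> :: real
  assumes \<alpha>: "\<alpha> > -1" and q: "q_crit \<alpha> < 0"
  defines "E \<equiv> 2 * (1 + \<alpha>)" and "B \<equiv> \<alpha> * (3 * \<alpha> + 4) / (\<alpha> + 2)"
  shows "E * (4 * E * (\<alpha> + 2) - B\<^sup>2) < 0"
proof -
  have "4 * ((\<alpha> + 1) * (3 * \<alpha> + 4)\<^sup>2) < \<alpha>\<^sup>2 * \<alpha>\<^sup>2"
    using q by (simp add: q_crit_def power2_eq_square power4_eq_xxxx)
  \<comment> \<open>For \<open>\<alpha> > -1\<close> the absolute value of \<alpha> is at most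
    \<open>\<alpha> + 2\<close>; this passes from the quartic in \<open>q_crit\<close> to the weaker
    condition that the symbol requires.\<close>
  also have "\<dots> \<le> \<alpha>\<^sup>2 * (\<alpha> + 2)\<^sup>2"
    using \<alpha> by (intro mult_left_mono) (auto simp: power2_eq_square algebra_simps)
  finally have "8 * (1 + \<alpha>) * (\<alpha> + 2) * (\<alpha> + 2)\<^sup>2 < (\<alpha> * (3 * \<alpha> + 4))\<^sup>2"
    by (simp add: power2_eq_square algebra_simps)
  then have "8 * (1 + \<alpha>) * (\<alpha> + 2) < B\<^sup>2"
    unfolding B_def power_divide using \<alpha> by (simp add: pos_less_divide_eq)
  then show ?thesis
    using \<alpha> by (simp add: E_def mult_less_0_iff)
qed

text \<open>High-frequency fields concentrated near \<open>x\<^sub>0 = (1, 0, 0)\<close> see only the symbol of the form at \<open>x\<^sub>0\<close>.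
  Its worst direction makes the angle \<open>\<pi> / 4\<close> with \<open>x\<^sub>0\<close>, whence \<open>\<xi> = (1, 1, 0)\<close>; the amplitude \<open>a\<close>
  minimises the resulting quadratic form in the plane of \<open>x\<^sub>0\<close> and \<open>\<xi>\<close> up to scaling.\<close>

lemma lame_not_pos_def:
  assumes \<alpha>: "\<alpha> > -1" and q: "q_crit \<alpha> < 0"
  shows "\<not> pos_def_with_weight (lame \<alpha>) (fundamental_matrix \<alpha>)"
proof
  assume pd: "pos_def_with_weight (lame \<alpha>) (fundamental_matrix \<alpha>)"
  define \<kappa> where "\<kappa> = \<alpha> / (\<alpha> + 2)"
  define E where "E = 2 * (1 + \<alpha>)"
  define B where "B = \<alpha> * (3 * \<alpha> + 4) / (\<alpha> + 2)"
  \<comment> \<open>In the plane the form is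
    \<open>E * a1^2 + B * a1 * a2 + (\<alpha> + 2) * a2^2\<close>. For fixed \<open>a2\<close> it is
    least at \<open>a1 = - B * a2 / (2 * E)\<close>, and \<open>a2 = 2 * E\<close> clears the
    denominator.\<close>
  define a :: "3 \<Rightarrow> real" where "a = (\<lambda>i. if i = 1 then - B else if i = 2 then 2 * E else 0)"
  define \<xi> :: "3 \<Rightarrow> real" where "\<xi> = (\<lambda>i. if i = 3 then 0 else 1)"
  \<comment> \<open>The symbol of the operator at \<xi> applied to \<open>a\<close>. Pairing it with
    \<open>a\<close> through the weight gives \<open>Z\<close>, the coefficient of the squared
    frequency.\<close>
  define m where "m = (\<lambda>i. (\<Sum>k\<in>UNIV. (\<xi> k)\<^sup>2) * a i + \<alpha> * \<xi> i * (\<Sum>k\<in>UNIV. \<xi> k * a k))"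
  define Z where "Z = (\<lambda>x. \<Sum>i\<in>UNIV. \<Sum>j\<in>UNIV. m i * lame_weight \<kappa> i j x * a j)"
  define x0 :: "real^3" where "x0 = axis 1 1"
  have n0: "norm x0 = 1" by (simp add: x0_def)
  have x0: "x0 \<noteq> 0" using n0 by auto
  have x0c: "x0 $ 1 = 1" "x0 $ 2 = 0" "x0 $ 3 = 0" by (simp_all add: x0_def axis_def)
  have Z0: "Z x0 < 0"
  proof -
    have "Z x0 = E * (4 * E * (\<alpha> + 2) - B\<^sup>2)"
    proof -
      have k: "(1 + \<kappa>) * (\<alpha> + 2) = E" "\<kappa> * (\<alpha> + 2) = \<alpha>" "B * (\<alpha> + 2) = \<alpha> * (3 * \<alpha> + 4)"
        using \<alpha> by (simp_all add: \<kappa>_def E_def B_def field_simps)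
      have "Z x0 = (2 * a 1 + \<alpha> * (a 1 + a 2)) * (1 + \<kappa>) * a 1 + (2 * a 2 + \<alpha> * (a 1 + a 2)) * a 2"
        unfolding Z_def sum_3 lame_weight_def rho_def n0 x0c m_def
        by (simp add: \<xi>_def a_def sum_3 algebra_simps)
      also have "\<dots> = ((1 + \<kappa>) * (\<alpha> + 2)) * (a 1)\<^sup>2 + (2 * \<alpha> + \<kappa> * \<alpha>) * (a 1 * a 2) + (\<alpha> + 2) * (a 2)\<^sup>2"
        by algebra
      also have "2 * \<alpha> + \<kappa> * \<alpha> = B"
        using \<alpha> by (simp add: \<kappa>_def B_def field_simps)
      finally show ?thesis
        unfolding k by (simp add: a_def power2_eq_square algebra_simps)
    qed
    then show ?thesis
      using symbol_negative[OF \<alpha> q] by (simp add: E_def B_def)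
  qed
  have Zc: "c1_off Z"
    unfolding Z_def by (intro c1_off_intros c1_off_lame_weight)
  have contZ: "isCont Z x0"
    using Zc x0 by (intro differentiable_imp_continuous_within c1_off_differentiable)
  have "\<forall>\<^sub>F x in nhds x0. Z x < 0"
    using contZ Z0 by (intro order_tendstoD(2)[of Z "Z x0"]) (auto simp: isCont_def tendsto_at_iff_tendsto_nhds)
  then obtain d0 where d0: "d0 > 0" "\<And>x. dist x x0 < d0 \<Longrightarrow> Z x < 0"
    by (auto simp: eventually_nhds_metric)
  \<comment> \<open>The bound 1/2 keeps the closed ball around \<open>x0\<close> away from the
    origin, at distance 1; the bound \<open>d0\<close> keeps \<open>Z\<close> negative on the open
    ball.\<close>
  define d where "d = min d0 (1/2)"
  have d: "d > 0" "d < 1" "\<And>x. dist x x0 < d \<Longrightarrow> Z x < 0"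
    using d0 by (auto simp: d_def)
  \<comment> \<open>The flat function of \<open>d^2\<close> minus the squared distance to
    \<open>x0\<close>, spelled out with sums and products of coordinates to fit the smoothness
    rules.\<close>
  define b where "b = (\<lambda>x::real^3. flat_exp 0 (d\<^sup>2 + (-1) * ((x $ 1 + (-1)) * (x $ 1 + (-1)) + x $ 2 * x $ 2 + x $ 3 * x $ 3)))"
  have b: "smooth b"
    unfolding b_def by (intro smooth_flat_exp smooth_add smooth_mult smooth_const smooth_coord)
  have dist2: "(dist x x0)\<^sup>2 = (x $ 1 + (-1)) * (x $ 1 + (-1)) + x $ 2 * x $ 2 + x $ 3 * x $ 3" for x
    unfolding dist_norm power2_norm_eq_inner by (simp add: inner_vec_def sum_3 x0c)
  have beq: "b x = flat_exp 0 (d\<^sup>2 - (dist x x0)\<^sup>2)" for x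
    unfolding b_def dist2 by (simp add: algebra_simps)
  have b0: "dist x x0 < d" if "b x \<noteq> 0" for x
  proof -
    have "(dist x x0)\<^sup>2 < d\<^sup>2"
      using that by (auto simp: beq flat_exp_def split: if_splits)
    then show ?thesis using d(1) by (simp add: power2_less_imp_less)
  qed
  have bx0: "b x0 > 0"
    using d(1) by (simp add: beq flat_exp_def)
  have cb: "0 \<notin> cball x0 d"
    using d(2) n0 by (simp add: dist_norm)
  have test: "test_fun (\<lambda>x. c * (b x * h x))" if "smooth h" for c h
    by (rule test_fun_if_0_off_cball[of _ x0 d])
      (use that b cb b0 in \<open>auto intro!: smooth_mult smooth_const simp: dist_commute less_imp_le\<close>)
  define J where "J = (\<lambda>U x. lame \<alpha> (\<lambda>y. \<chi> i. U i y) x \<bullet> (fundamental_matrix \<alpha> x *v (\<chi> i. U i x)))"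
  have Jint: "integrable lborel (J (\<lambda>i y. a i * (b y * h y)))" if "smooth h" for h
    unfolding J_def by (intro integrable_lame_form test that)
  have Jpos: "0 \<le> (LINT x|lborel. J (\<lambda>i y. a i * (b y * h y)) x)" if "smooth h" for h
  proof -
    have "\<forall>i. test_fun (\<lambda>x. (\<chi> i. a i * (b x * h x)) $ i)"
      using test[OF that] by simp
    then show ?thesis
      using pd[unfolded pos_def_with_weight_def, rule_format, of "\<lambda>x. \<chi> i. a i * (b x * h x)"]
      unfolding J_def by simp
  qed
  have Jeq: "J (\<lambda>i y. a i * (b y * h y)) x = c_lame \<alpha> * (\<Sum>i\<in>UNIV. \<Sum>j\<in>UNIV.
      (lame \<alpha> (\<lambda>y. \<chi> i. a i * (b y * h y)) x $ i * (b x * h x)) * lame_weight \<kappa> i j x * a j)" for h x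
    unfolding J_def lame_fundamental_matrix_integrand \<kappa>_def by (simp add: mult_ac)
  \<comment> \<open>The factor 1 casts the unmodulated field in the shape \<open>b y * h y\<close>,
    so that \<open>Jint\<close> and \<open>Jeq\<close> cover it with \<open>h\<close>
    constant.\<close>
  define I where "I = (LINT x|lborel. J (\<lambda>i y. a i * (b y * 1)) x)"
  have bZ: "integrable lborel (\<lambda>x. - ((b x)\<^sup>2 * Z x))"
    by (rule integrable_if_0_off[of _ "cball x0 d"])
      (intro c1_off_continuous c1_off_intros Zc smooth_c1_off b,
        use cb b0 in \<open>auto simp: dist_commute intro: less_imp_le\<close>)
  define D where "D = c_lame \<alpha> * (LINT x|lborel. - ((b x)\<^sup>2 * Z x))"
  have "0 < (LINT x|lborel. - ((b x)\<^sup>2 * Z x))"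
  proof (rule integral_pos_if_continuous[OF bZ])
    show "0 \<le> - ((b x)\<^sup>2 * Z x)" for x
      using d(3)[of x] b0[of x] by (cases "b x = 0") (auto simp: mult_le_0_iff intro: less_imp_le)
    show "isCont (\<lambda>x. - ((b x)\<^sup>2 * Z x)) x0"
      using contZ differentiable_imp_continuous_within[OF smooth_differentiable[OF b]] by (intro continuous_intros)
    show "0 < - ((b x0)\<^sup>2 * Z x0)"
      using bx0 Z0 by (simp add: mult_less_0_iff)
  qed
  moreover have "c_lame \<alpha> > 0"
    using \<alpha> by (simp add: c_lame_def)
  ultimately have D: "D > 0"
    unfolding D_def by (rule mult_pos_pos[rotated])
  \<comment> \<open>The cosine and sine fields both have nonnegative form. The two forms add up to
    that of the unmodulated field minus the squared frequency times \<open>D\<close>.\<close>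
  have main: "0 \<le> I - N\<^sup>2 * D" for N
  proof -
    define l where "l = (\<lambda>y::real^3. N * (y $ 1 + y $ 2))"
    have l: "smooth l"
      unfolding l_def by (intro smooth_add smooth_mult smooth_const smooth_coord)
    have pl: "pd k l x = N * \<xi> k" for k x
    proof -
      have "pd k l x = N * ((if 1 = k then 1 else 0) + (if 2 = k then 1 else 0))"
        unfolding l_def by (simp add: pd_mult pd_add pd_const pd_coord smooth_differentiable smooth_coord)
      then show ?thesis using exhaust_3[of k] by (auto simp: \<xi>_def)
    qed
    have sm: "smooth (\<lambda>y. cos (l y))" "smooth (\<lambda>y. sin (l y))" "smooth (\<lambda>y. 1)"
      by (intro smooth_sin_cos l smooth_const)+
    have "J (\<lambda>i y. a i * (b y * cos (l y))) x + J (\<lambda>i y. a i * (b y * sin (l y))) x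
        = J (\<lambda>i y. a i * (b y * 1)) x - N\<^sup>2 * (c_lame \<alpha> * - ((b x)\<^sup>2 * Z x))" for x
    proof -
      have "J (\<lambda>i y. a i * (b y * cos (l y))) x + J (\<lambda>i y. a i * (b y * sin (l y))) x
        = c_lame \<alpha> * (\<Sum>i\<in>UNIV. \<Sum>j\<in>UNIV. (lame \<alpha> (\<lambda>y. \<chi> i. a i * (b y * cos (l y))) x $ i * (b x * cos (l x))
            + lame \<alpha> (\<lambda>y. \<chi> i. a i * (b y * sin (l y))) x $ i * (b x * sin (l x))) * lame_weight \<kappa> i j x * a j)"
        unfolding Jeq distrib_left[symmetric] distrib_right sum.distrib ..
      also have "\<dots> = c_lame \<alpha> * ((\<Sum>i\<in>UNIV. \<Sum>j\<in>UNIV. lame \<alpha> (\<lambda>y. \<chi> i. a i * b y) x $ i * b x * lame_weight \<kappa> i j x * a j)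
          + N\<^sup>2 * (b x)\<^sup>2 * Z x)"
      proof -
        have osc: "lame \<alpha> (\<lambda>y. \<chi> i. a i * (b y * cos (l y))) x $ i * (b x * cos (l x))
            + lame \<alpha> (\<lambda>y. \<chi> i. a i * (b y * sin (l y))) x $ i * (b x * sin (l x))
          = lame \<alpha> (\<lambda>y. \<chi> i. a i * b y) x $ i * b x + N\<^sup>2 * m i * (b x)\<^sup>2" for i
          unfolding m_def by (rule lame_oscillation[OF b l pl])
        show ?thesis
          unfolding osc Z_def unfolding sum_3 by algebra
      qed
      finally show ?thesis
        unfolding Jeq by (simp add: algebra_simps)
    qed
    then have "(LINT x|lborel. J (\<lambda>i y. a i * (b y * cos (l y))) x + J (\<lambda>i y. a i * (b y * sin (l y))) x)
        = (LINT x|lborel. J (\<lambda>i y. a i * (b y * 1)) x - N\<^sup>2 * (c_lame \<alpha> * - ((b x)\<^sup>2 * Z x)))"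
      by simp
    also have "\<dots> = I - N\<^sup>2 * D"
      unfolding I_def D_def using Jint[OF sm(3)] bZ by (subst Bochner_Integration.integral_diff) simp_all
    finally show ?thesis
      using Jpos[OF sm(1)] Jpos[OF sm(2)] Jint[OF sm(1)] Jint[OF sm(2)] by simp
  qed
  \<comment> \<open>Large enough that \<open>N * D\<close> exceeds \<open>I\<close>, and at least 1
    so that squaring does not decrease it.\<close>
  define N where "N = 1 + \<bar>I\<bar> / D"
  have "I < N * D" using D by (simp add: N_def distrib_right)
  also have "\<dots> \<le> N\<^sup>2 * D"
    using D by (intro mult_right_mono self_le_power) (auto simp: N_def)
  finally show False using main[of N] by simp
qed

subsection \<open>The constants\<close>

text \<open>A sign change encloses a root between \<open>a\<close> and \<open>b\<close>. Left of the
  least root a nonnegative value would force, by the intermediate value theorem starting from a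
  point at or below \<open>a\<close>, a still smaller root.\<close>

lemma Min_root:
  fixes p :: "real \<Rightarrow> real"
  assumes cont: "continuous_on UNIV p" and fin: "finite {t. p t = 0}"
    and neg: "\<And>t. t \<le> a \<Longrightarrow> p t < 0" and pos: "p b > 0" "a < b"
  shows "a < Min {t. p t = 0}" "Min {t. p t = 0} < b" "t < Min {t. p t = 0} \<Longrightarrow> p t < 0"
proof -
  have ivt: "\<exists>x\<ge>l. x \<le> r \<and> p x = 0" if "l \<le> r" "p l \<le> 0" "0 \<le> p r" for l r
    using IVT'[of p l 0 r] that cont by (auto intro: continuous_on_subset)
  have "\<exists>x\<ge>a. x \<le> b \<and> p x = 0" using neg[of a] pos by (intro ivt) auto
  then obtain x where x: "a \<le> x" "x \<le> b" "p x = 0" by blast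
  have M: "Min {t. p t = 0} \<in> {t. p t = 0}" using fin x by (intro Min_in) auto
  show "a < Min {t. p t = 0}" using M neg by (metis linorder_not_le mem_Collect_eq order_less_irrefl)
  have "Min {t. p t = 0} \<le> x" using fin x by simp
  then show "Min {t. p t = 0} < b" using x pos by (metis order_less_irrefl order_le_less_trans nless_le)
  assume t: "t < Min {t. p t = 0}"
  show "p t < 0"
  proof (rule ccontr)
    assume "\<not> p t < 0"
    then have "\<exists>x\<ge>min a t. x \<le> t \<and> p x = 0" by (intro ivt) (use neg[of "min a t"] in auto)
    then obtain y where y: "y \<le> t" "p y = 0" by blast
    then have "Min {t. p t = 0} \<le> y" using fin by simp
    with y t show False by simp
  qed
qed

text \<open>The mirror image of \<open>Min_root\<close>, with the sign pattern read from the
  right.\<close>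

lemma Max_root:
  fixes p :: "real \<Rightarrow> real"
  assumes cont: "continuous_on UNIV p" and fin: "finite {t. p t = 0}"
    and neg: "\<And>t. b \<le> t \<Longrightarrow> p t < 0" and pos: "p a > 0" "a < b"
  shows "a < Max {t. p t = 0}" "Max {t. p t = 0} < b" "Max {t. p t = 0} < t \<Longrightarrow> p t < 0"
proof -
  have ivt: "\<exists>x\<ge>l. x \<le> r \<and> p x = 0" if "l \<le> r" "p r \<le> 0" "0 \<le> p l" for l r
    using IVT2'[of p r 0 l] that cont by (auto intro: continuous_on_subset)
  have "\<exists>x\<ge>a. x \<le> b \<and> p x = 0" using neg[of b] pos by (intro ivt) auto
  then obtain x where x: "a \<le> x" "x \<le> b" "p x = 0" by blast
  have M: "Max {t. p t = 0} \<in> {t. p t = 0}" using fin x by (intro Max_in) auto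
  show "Max {t. p t = 0} < b" using M neg by (metis linorder_not_le mem_Collect_eq order_less_irrefl)
  have "x \<le> Max {t. p t = 0}" using fin x by simp
  then show "a < Max {t. p t = 0}" using x pos by (metis order_less_irrefl order_less_le_trans nless_le)
  assume t: "Max {t. p t = 0} < t"
  show "p t < 0"
  proof (rule ccontr)
    assume "\<not> p t < 0"
    then have "\<exists>x\<ge>t. x \<le> max b t \<and> p x = 0" by (intro ivt) (use neg[of "max b t"] in auto)
    then obtain y where y: "t \<le> y" "p y = 0" by blast
    then have "y \<le> Max {t. p t = 0}" using fin by simp
    with y t show False by simp
  qed
qed

lemma finite_roots_poly:
  fixes p :: "real poly"
  assumes "\<And>t. f t = poly p t" "p \<noteq> 0"
  shows "finite {t. f t = 0}"
  using poly_roots_finite[OF assms(2)] by (simp add: assms(1))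

lemma sqrt_bounds: "1.4142 < sqrt 2" "sqrt 2 < 1.4143" "1.732 < sqrt 3" "sqrt 3 < 1.7321"
  "2.4494 < sqrt 6" "sqrt 6 < 2.4495"
  by (rule real_less_rsqrt real_less_lsqrt; simp add: power2_eq_square)+

text \<open>Beyond each outer bound \<open>q_crit\<close> is expanded in the distance
  \<open>s \<ge> 0\<close> to that bound, where its sign can be read off the coefficients or follows
  from a short estimate.\<close>

lemma alpha_c_bounds:
  shows "-0.903 < alpha_c_minus" "alpha_c_minus < -0.901" "t < alpha_c_minus \<Longrightarrow> q_crit t < 0"
    "39.449 < alpha_c_plus" "alpha_c_plus < 39.451" "alpha_c_plus < t \<Longrightarrow> q_crit t < 0"
proof -
  have cont: "continuous_on UNIV q_crit"
    unfolding q_crit_def[abs_def] by (intro continuous_intros) auto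
  have fin: "finite {t. q_crit t = 0}"
    by (rule finite_roots_poly[of _ "[:16, 40, 33, 9, -1/4:]"])
      (auto simp: q_crit_def power2_eq_square power4_eq_xxxx algebra_simps)
  have "q_crit t < 0" if "t \<le> -0.903" for t
  proof -
    define s where "s = -0.903 - t"
    have s: "0 \<le> s" using that by (simp add: s_def)
    have t: "t = -0.903 - s" by (simp add: s_def)
    have "q_crit t = - (18219609281 / 4000000000000) - (s ^ 4 / 4
        + s * (3154357327 / 1000000000 - 14791773 / 2000000 * s + 9903 / 1000 * s\<^sup>2))"
      unfolding t q_crit_def by algebra
    also have "\<dots> < 0"
    proof -
      \<comment> \<open>Replaces the square by its tangent at 2/5, close to the minimiser (about
        0.37) of the quadratic below; the resulting linear bound has positive constant and
        slope.\<close>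
      have "0 \<le> (s - 2 / 5)\<^sup>2" by simp
      then have "4 / 5 * s - 4 / 25 \<le> s\<^sup>2" by (simp add: power2_eq_square field_simps)
      then have "0 \<le> s * (3154357327 / 1000000000 - 14791773 / 2000000 * s + 9903 / 1000 * s\<^sup>2)"
        using s by (intro mult_nonneg_nonneg) linarith+
      moreover have "0 \<le> s ^ 4" using s by simp
      ultimately show ?thesis by linarith
    qed
    finally show ?thesis .
  qed
  note Min_root[where p = q_crit and a = "-0.903" and b = "-0.901", OF cont fin this]
  then
  show "-0.903 < alpha_c_minus" "alpha_c_minus < -0.901" "t < alpha_c_minus \<Longrightarrow> q_crit t < 0"
    unfolding alpha_c_minus_def by (simp_all add: q_crit_def[of "-0.901"] q_crit_def[of "-(901/1000)"] power2_eq_square power4_eq_xxxx)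
  have "q_crit t < 0" if "39.451 \<le> t" for t
  proof -
    define s where "s = t - 39.451"
    have s: "0 \<le> s" using that by (simp add: s_def)
    have t: "t = 39.451 + s" by (simp add: s_def)
    have "q_crit t = - (75665016086801 / 4000000000000) - (16734738823851 / 1000000000 * s
        + 2472790203 / 2000000 * s ^ 2 + 30451 / 1000 * s ^ 3 + s ^ 4 / 4)"
      unfolding t q_crit_def by algebra
    also have "\<dots> < 0"
    proof -
      have "0 \<le> 16734738823851 / 1000000000 * s
        + 2472790203 / 2000000 * s ^ 2 + 30451 / 1000 * s ^ 3 + s ^ 4 / 4"
        using s by (intro add_nonneg_nonneg mult_nonneg_nonneg) auto
      then show ?thesis by linarith
    qed
    finally show ?thesis .
  qed
  note Max_root[where p = q_crit and a = "39.449" and b = "39.451", OF cont fin this]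
  then
  show "39.449 < alpha_c_plus" "alpha_c_plus < 39.451" "alpha_c_plus < t \<Longrightarrow> q_crit t < 0"
    unfolding alpha_c_plus_def by (simp_all add: q_crit_def[of "39.449"] q_crit_def[of "39449/1000"] power2_eq_square power4_eq_xxxx)
qed

lemma alpha_plus_bounds: "1.523 < alpha_plus" "alpha_plus < 1.525"
proof -
  \<comment> \<open>The sign is reversed so that \<open>p\<close> is negative to the right, as
    \<open>Max_root\<close> expects.\<close>
  define p where "p = (\<lambda>t. - (6 * t^5 + (23 + 3 * sqrt 2) * t^4 + (13 + 19 * sqrt 2) * t^3
     - (77 - 38 * sqrt 2) * t^2 - (157 - 24 * sqrt 2) * t - 96))"
  have cont: "continuous_on UNIV p"
    unfolding p_def by (intro continuous_intros)
  have fin: "finite {t. p t = 0}"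
    by (rule finite_roots_poly[of _ "[:96, 157 - 24 * sqrt 2, 77 - 38 * sqrt 2, - (13 + 19 * sqrt 2),
        - (23 + 3 * sqrt 2), -6:]"])
      (simp_all add: p_def power_numeral_reduce algebra_simps)
  have neg: "p t < 0" if "1.525 \<le> t" for t
  proof -
    define s where "s = t - 1.525"
    have s: "0 \<le> s" using that by (simp add: s_def)
    have t: "t = 1525 / 1000 + s" by (simp add: s_def)
    \<comment> \<open>Taylor expansion at 1.525. Only the constant term mixes signs; the lower bound
      1.4142 for the root of 2 settles it.\<close>
    have "p t = - (-15078825837 / 51200000 + 533975883 / 2560000 * sqrt 2)
        - ((47971971 / 256000 + 5040313 / 16000 * sqrt 2) * s
        + (1651859 / 3200 + 133429 / 800 * sqrt 2) * s ^ 2 + (23427 / 80 + 373 / 10 * sqrt 2) * s ^ 3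
        + (275 / 4 + 3 * sqrt 2) * s ^ 4 + 6 * s ^ 5)"
      unfolding t p_def by algebra
    also have "\<dots> < 0"
    proof -
      have "0 \<le> (47971971 / 256000 + 5040313 / 16000 * sqrt 2) * s
        + (1651859 / 3200 + 133429 / 800 * sqrt 2) * s ^ 2 + (23427 / 80 + 373 / 10 * sqrt 2) * s ^ 3
        + (275 / 4 + 3 * sqrt 2) * s ^ 4 + 6 * s ^ 5"
        using s by (intro add_nonneg_nonneg mult_nonneg_nonneg) auto
      moreover have "- (-15078825837 / 51200000 + 533975883 / 2560000 * sqrt 2) < 0"
        using sqrt_bounds(1) by (simp add: field_simps)
      ultimately show ?thesis by linarith
    qed
    finally show ?thesis .
  qed
  have "p 1.523 = - (- 147440517835096971 / 500000000000000 + 207954957018523 / 1000000000000 * sqrt 2)"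
    by (simp add: p_def power_numeral_reduce field_simps)
  also have "\<dots> > 0" using sqrt_bounds(2) by (simp add: field_simps)
  finally have pos: "p 1.523 > 0" .
  have eq: "alpha_plus = Max {t. p t = 0}"
    unfolding alpha_plus_def p_def by (simp only: neg_equal_0_iff_equal)
  show "1.523 < alpha_plus" "alpha_plus < 1.525"
    using Max_root(1,2)[where p = p and a = "1.523" and b = "1.525", OF cont fin neg pos] unfolding eq by simp_all
qed

lemma alpha_minus_bounds: "-0.195 < alpha_minus" "alpha_minus < -0.193"
proof -
  define p where "p = (\<lambda>t. - (2 + 7 * sqrt 3) * t^4
     + 2 * (15 + sqrt 2 - 11 * sqrt 3 + sqrt 6) * t^3
     + 2 * (57 + 3 * sqrt 2 - 10 * sqrt 3 + 3 * sqrt 6) * t^2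
     + 6 * (20 + sqrt 2 + sqrt 6) * t + 24)"
  have cont: "continuous_on UNIV p"
    unfolding p_def by (intro continuous_intros)
  have "2 + 7 * sqrt 3 > 0" by (simp add: add_pos_pos)
  then have "- (2 + 7 * sqrt 3) \<noteq> 0" by linarith
  then have fin: "finite {t. p t = 0}"
    by (intro finite_roots_poly[of _ "[:24, 6 * (20 + sqrt 2 + sqrt 6),
        2 * (57 + 3 * sqrt 2 - 10 * sqrt 3 + 3 * sqrt 6), 2 * (15 + sqrt 2 - 11 * sqrt 3 + sqrt 6),
        - (2 + 7 * sqrt 3):]"])
      (auto simp add: p_def power_numeral_reduce algebra_simps)
  have neg: "p t < 0" if "t \<le> -0.195" for t
  proof -
    define s where "s = -0.195 - t"
    have s: "0 \<le> s" using that by (simp add: s_def)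
    have t: "t = -(195 / 1000) - s" by (simp add: s_def)
    \<comment> \<open>Up to sign, \<open>c0\<close> to \<open>c4\<close> are the coefficients of
      \<open>p\<close> expanded in the distance \<open>s\<close> to the left of -0.195. The terms
      beyond \<open>c0\<close> are compared with a cubic having rounded coefficients.\<close>
    define c0 where "c0 = 3767609559 / 800000000 - 3826719 / 4000000 * sqrt 2 - 971990487 / 1600000000 * sqrt 3
        - 3826719 / 4000000 * sqrt 6"
    define c1 where "c1 = 79021569 / 1000000 + 77763 / 20000 * sqrt 2 + 10995933 / 2000000 * sqrt 3 + 77763 / 20000 * sqrt 6"
    define c2 where "c2 = 959937 / 10000 + 483 / 100 * sqrt 2 - 174541 / 20000 * sqrt 3 + 483 / 100 * sqrt 6"
    define c3 where "c3 = 789 / 25 + 2 * sqrt 2 - 827 / 50 * sqrt 3 + 2 * sqrt 6"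
    define c4 where "c4 = 2 + 7 * sqrt 3"
    have "p t = c0 - s * (c1 - c2 * s + c3 * s\<^sup>2 + c4 * s ^ 3)"
      unfolding t p_def c0_def c1_def c2_def c3_def c4_def by algebra
    also have "\<dots> < 0"
    proof -
      have c: "c0 < 0" "1035 / 10 \<le> c1" "c2 \<le> 996 / 10" "106 / 10 \<le> c3" "141 / 10 \<le> c4"
        unfolding c0_def c1_def c2_def c3_def c4_def using sqrt_bounds by simp_all
      \<comment> \<open>The rounded cubic has its minimum for positive \<open>s\<close> near 1.31.
        Replacing the square and the cube by their tangents there leaves a linear function with
        positive constant and slope.\<close>
      have "0 \<le> (s - 131 / 100)\<^sup>2" by simp
      then have s2: "262 / 100 * s - 17161 / 10000 \<le> s\<^sup>2" by (simp add: power2_eq_square field_simps)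
      have "0 \<le> (s - 131 / 100)\<^sup>2 * (s + 262 / 100)" using s by simp
      then have s3: "51483 / 10000 * s - 4496182 / 1000000 \<le> s ^ 3"
        by (simp add: power2_eq_square power3_eq_cube field_simps)
      have "0 \<le> 1035 / 10 - 996 / 10 * s + 106 / 10 * s\<^sup>2 + 141 / 10 * s ^ 3"
        using s s2 s3 by linarith
      also have "\<dots> \<le> c1 - c2 * s + c3 * s\<^sup>2 + c4 * s ^ 3"
        using c s by (intro add_mono diff_mono mult_right_mono) auto
      finally have "0 \<le> s * (c1 - c2 * s + c3 * s\<^sup>2 + c4 * s ^ 3)" using s by simp
      with c(1) show ?thesis by linarith
    qed
    finally show ?thesis .
  qed
  have pos: "p (-0.193) > 0"
    using sqrt_bounds by (simp add: p_def power_numeral_reduce field_simps)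
  have eq: "alpha_minus = Min {t. p t = 0}"
    unfolding alpha_minus_def p_def ..
  show "-0.195 < alpha_minus" "alpha_minus < -0.193"
    using Min_root(1,2)[where p = p and a = "-0.195" and b = "-0.193", OF cont fin neg pos] unfolding eq by simp_all
qed

section \<open>The two parameter ranges and the numerical values of the constants\<close>

theorem theorem1p2:
  fixes \<alpha> :: real
  assumes "\<alpha> > -1"
  shows "(alpha_minus < \<alpha> \<and> \<alpha> < alpha_plus \<longrightarrow>
            pos_def_with_weight (lame \<alpha>) (fundamental_matrix \<alpha>))
       \<and> (\<alpha> < alpha_c_minus \<or> \<alpha> > alpha_c_plus \<longrightarrow>
            \<not> pos_def_with_weight (lame \<alpha>) (fundamental_matrix \<alpha>))
       \<and> \<bar>alpha_minus - (-0.194)\<bar> < 0.001 \<and> \<bar>alpha_plus - 1.524\<bar> < 0.001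
       \<and> \<bar>alpha_c_minus - (-0.902)\<bar> < 0.001 \<and> \<bar>alpha_c_plus - 39.450\<bar> < 0.001"
proof -
  have "pos_def_with_weight (lame \<alpha>) (fundamental_matrix \<alpha>)" if "alpha_minus < \<alpha>" "\<alpha> < alpha_plus"
    using that alpha_minus_bounds alpha_plus_bounds by (intro lame_pos_def) simp_all
  moreover have "\<not> pos_def_with_weight (lame \<alpha>) (fundamental_matrix \<alpha>)"
    if "\<alpha> < alpha_c_minus \<or> \<alpha> > alpha_c_plus"
    using that alpha_c_bounds(3,6) lame_not_pos_def[OF assms] by blast
  moreover have "\<bar>alpha_minus - (-0.194)\<bar> < 0.001"
    using alpha_minus_bounds by (simp add: abs_if field_simps)
  moreover have "\<bar>alpha_plus - 1.524\<bar> < 0.001"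
    using alpha_plus_bounds by (simp add: abs_if field_simps)
  moreover have "\<bar>alpha_c_minus - (-0.902)\<bar> < 0.001" "\<bar>alpha_c_plus - 39.450\<bar> < 0.001"
    using alpha_c_bounds(1,2,4,5) by (simp_all add: abs_if field_simps)
  ultimately show ?thesis by blast
qed

end
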